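(* Let $K=\mathbb{F}_q$ be a finite field, let $n,s\ge 1$, let $v_1,\ldots,v_s\in\mathbb{N}^n$, and let $X^*\subset\mathbb{A}^s=K^s$ be the affine algebraic toric set parameterized by $y^{v_1},\ldots,y^{v_s}$, with points $P_1,\ldots,P_m$. Let $Y\subset\mathbb{P}^s$ be the image of $X^*$ under $x\mapsto[(x,1)]$, with points $[(P_1,1)],\ldots,[(P_m,1)]$. Let $d\ge 0$ be an integer and $f_0=t_1^d$. Then: (a) There is an isomorphism of $K$-vector spaces $\varphi\colon C_{X^*}(d)\to C_Y(d)$ given, for $f\in S_{\le d}$, by $$ (f(P_1),\ldots,f(P_m))\longmapsto \left(\frac{f^{\mathfrak{h}}(P_1,1)}{f_0(P_1,1)},\ldots,\frac{f^{\mathfrak{h}}(P_m,1)}{f_0(P_m,1)}\right)= \left(\frac{f(P_1)}{f_0(P_1)},\ldots,\frac{f(P_m)}{f_0(P_m)}\right). $$ (b) The codes $C_{X^*}(d)$ and $C_Y(d)$ have the same parameters, i.e. the same length, the same dimension and the same minimum distance. (c) The dimension of $C_{X^*}(d)$ is $H_Y(d)$ and the length of $C_{X^*}(d)$ is $\deg(S[u]/I(Y))$.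
   Context: $\mathbb{N}$ contains $0$ and $K^*=K\setminus\{0\}$. For $v_i=(v_{i1},\ldots,v_{in})\in\mathbb{N}^n$, $y^{v_i}=y_1^{v_{i1}}\cdots y_n^{v_{in}}$. The affine algebraic toric set parameterized by $y^{v_1},\ldots,y^{v_s}$ is $$X^*=\{(x_1^{v_{11}}\cdots x_n^{v_{1n}},\ldots,x_1^{v_{s1}}\cdots x_n^{v_{sn}})\in K^s\mid x_1,\ldots,x_n\in K^*\}.$$ $S=K[t_1,\ldots,t_s]$, $S_{\le d}$ is the space of polynomials of degree at most $d$, and $S[u]=K[t_1,\ldots,t_s,u]$ (with $u=t_{s+1}$) has the standard grading with degree-$d$ part $S[u]_d$. The parameterized affine code $C_{X^*}(d)\subset K^{m}$, $m=|X^*|$, is the image of the linear map $S_{\le d}\to K^m$, $f\mapsto(f(P_1),\ldots,f(P_m))$. The parameterized projective code $C_Y(d)\subset K^m$ is the image of the linear map $S[u]_d\to K^m$, $f\mapsto\left(\frac{f(Q_1)}{f_0(Q_1)},\ldots,\frac{f(Q_m)}{f_0(Q_m)}\right)$, where $f_0=t_1^d$ and $Q_i=(P_i,1)$. (The map does not depend on the choice of representatives $Q_i$ of the points of $Y$; $f_0$ is also regarded as a polynomial in $S$, so $f_0(P_i)=f_0(P_i,1)$.) For $f\in S_{\le d}$, $f^{\mathfrak{h}}:=u^d f(t_1/u,\ldots,t_s/u)\in S[u]_d$. The length of a linear code in $K^m$ is $m$, its dimension is its dimension as a $K$-vector space, and its minimum distance is the minimum number of non-zero entries of a non-zero vector of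 the code. $I(Y)\subset S[u]$ is the vanishing ideal of $Y$, the ideal generated by the homogeneous polynomials vanishing on $Y$. Its Hilbert function is $H_Y(d)=\dim_K(S[u]_d/(I(Y)\cap S[u]_d))$. If $k$ is the Krull dimension of $S[u]/I(Y)$ and $h_Y(t)=\sum_{i=0}^{k-1}c_it^i$ is the Hilbert polynomial (of degree $k-1$, with $h_Y(d)=H_Y(d)$ for $d\gg0$), the degree of $S[u]/I(Y)$ is $\deg(S[u]/I(Y))=c_{k-1}(k-1)!$. *)

theory Defs
  imports
    "HOL-Algebra.QuotRing"
    "HOL-Library.Poly_Mapping"
    "HOL-Library.Extended_Nat"
    "HOL-Computational_Algebra.Normalized_Fraction"
    "Jordan_Normal_Form.VS_Connect"
begin

section \<open>Polynomials in finitely many variables\<close>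

text \<open>
  Variables are numbered from \<open>0\<close>: the variable \<open>t\<^sub>i\<^sub>+\<^sub>1\<close> of the mathematical text has index \<open>i\<close>,
  and \<open>u = t\<^sub>s\<^sub>+\<^sub>1\<close> has index \<open>s\<close>.  Thus \<open>S = K[t\<^sub>1,\<dots>,t\<^sub>s]\<close> is a subset of \<open>S[u]\<close>.
\<close>

type_synonym 'k mpol = "(nat \<Rightarrow>\<^sub>0 nat) \<Rightarrow>\<^sub>0 'k"

definition tvar :: "nat \<Rightarrow> 'k::comm_ring_1 mpol" where
  "tvar i = Poly_Mapping.single (Poly_Mapping.single i 1) 1"

definition mdeg :: "(nat \<Rightarrow>\<^sub>0 nat) \<Rightarrow> nat" where
  "mdeg a = (\<Sum>i\<in>Poly_Mapping.keys a. Poly_Mapping.lookup a i)"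

definition polys :: "nat \<Rightarrow> 'k::comm_ring_1 mpol set" where
  "polys r = {f. \<forall>a\<in>Poly_Mapping.keys f. Poly_Mapping.keys a \<subseteq> {..<r}}"

definition polys_le :: "nat \<Rightarrow> nat \<Rightarrow> 'k::comm_ring_1 mpol set" where
  "polys_le r d = {f \<in> polys r. \<forall>a\<in>Poly_Mapping.keys f. mdeg a \<le> d}"

definition polys_hom :: "nat \<Rightarrow> nat \<Rightarrow> 'k::comm_ring_1 mpol set" where
  "polys_hom r d = {f \<in> polys r. \<forall>a\<in>Poly_Mapping.keys f. mdeg a = d}"

definition peval :: "'k::comm_ring_1 mpol \<Rightarrow> 'k vec \<Rightarrow> 'k" where
  "peval f x = (\<Sum>a\<in>Poly_Mapping.keys f. Poly_Mapping.lookup f a *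
     (\<Prod>i\<in>Poly_Mapping.keys a. (x $ i) ^ Poly_Mapping.lookup a i))"

text \<open>The polynomial ring in \<open>r\<close> variables as a \<open>K\<close>-algebra.\<close>

definition poly_alg :: "nat \<Rightarrow> ('k::comm_ring_1, 'k mpol) module" where
  "poly_alg r = \<lparr>carrier = polys r, mult = (*), one = 1, zero = 0, add = (+),
     smult = (\<lambda>c f. Poly_Mapping.single 0 c * f)\<rparr>"

text \<open>
  The expanded form of \<open>u\<^sup>d f(t\<^sub>1/u,\<dots>,t\<^sub>s/u)\<close>; the lemma below it is that formula, read in the
  fraction field.
\<close>

definition homogenize :: "nat \<Rightarrow> nat \<Rightarrow> 'k::comm_ring_1 mpol \<Rightarrow> 'k mpol" where
  "homogenize s d f = (\<Sum>a\<in>Poly_Mapping.keys f.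
     Poly_Mapping.single (a + Poly_Mapping.single s (d - mdeg a)) (Poly_Mapping.lookup f a))"

lemma prod_tvar_power:
  "finite A \<Longrightarrow> (\<Prod>i\<in>A. tvar i ^ g i) =
     (Poly_Mapping.single (\<Sum>i\<in>A. Poly_Mapping.single i (g i)) 1 :: 'k::comm_ring_1 mpol)"
proof (induction A rule: finite_induct)
  case (insert i A)
  have "tvar i ^ e = (Poly_Mapping.single (Poly_Mapping.single i e) 1 :: 'k mpol)" for e
    by (induction e) (simp_all add: tvar_def mult_single flip: single_add)
  with insert show ?case by (simp add: mult_single)
qed simp

lemma sum_single_keys:
  "(\<Sum>i\<in>Poly_Mapping.keys a. Poly_Mapping.single i (Poly_Mapping.lookup a i)) = a"
proof (rule poly_mapping_eqI)
  fix k
  show "Poly_Mapping.lookup (\<Sum>i\<in>Poly_Mapping.keys a.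
      Poly_Mapping.single i (Poly_Mapping.lookup a i)) k = Poly_Mapping.lookup a k"
    by (simp add: lookup_sum lookup_single when_def in_keys_iff)
qed

lemma homogenize_fract:
  fixes f :: "'k::field mpol"
  assumes "f \<in> polys_le s d"
  shows "to_fract (homogenize s d f) = to_fract (tvar s) ^ d *
    (\<Sum>a\<in>Poly_Mapping.keys f. to_fract (Poly_Mapping.single 0 (Poly_Mapping.lookup f a)) *
      (\<Prod>i\<in>Poly_Mapping.keys a. (to_fract (tvar i) / to_fract (tvar s)) ^ Poly_Mapping.lookup a i))"
proof -
  have hom1: "to_fract (x ^ n) = to_fract x ^ n" for x :: "'k mpol" and n
    by (induction n) simp_all
  have hom2: "to_fract (\<Prod>i\<in>A. g i) = (\<Prod>i\<in>A. to_fract (g i))"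
    for A :: "nat set" and g :: "nat \<Rightarrow> 'k mpol"
    by (induction A rule: infinite_finite_induct) simp_all
  have hom3: "to_fract (\<Sum>i\<in>B. h i) = (\<Sum>i\<in>B. to_fract (h i))"
    for B :: "(nat \<Rightarrow>\<^sub>0 nat) set" and h :: "(nat \<Rightarrow>\<^sub>0 nat) \<Rightarrow> 'k mpol"
    by (induction B rule: infinite_finite_induct) simp_all
  note hom = hom1 hom2 hom3
  let ?u = "to_fract (tvar s :: 'k mpol)"
  have "(tvar s :: 'k mpol) \<noteq> 0"
    by (metis lookup_single_eq lookup_zero tvar_def zero_neq_one)
  then have u: "?u \<noteq> 0" by simp
  have "to_fract (Poly_Mapping.single (a + Poly_Mapping.single s (d - mdeg a)) (Poly_Mapping.lookup f a))
    = ?u ^ d * (to_fract (Poly_Mapping.single 0 (Poly_Mapping.lookup f a)) *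
      (\<Prod>i\<in>Poly_Mapping.keys a. (to_fract (tvar i) / ?u) ^ Poly_Mapping.lookup a i))"
    if a: "a \<in> Poly_Mapping.keys f" for a
  proof -
    have le: "mdeg a \<le> d" using assms a by (auto simp: polys_le_def)
    have m: "(\<Prod>i\<in>Poly_Mapping.keys a. tvar i ^ Poly_Mapping.lookup a i)
        = (Poly_Mapping.single a 1 :: 'k mpol)"
      by (simp add: prod_tvar_power sum_single_keys)
    have s: "tvar s ^ e = (Poly_Mapping.single (Poly_Mapping.single s e) 1 :: 'k mpol)" for e
      using prod_tvar_power[of "{s}" "\<lambda>_. e"] by simp
    have "(Poly_Mapping.single (a + Poly_Mapping.single s (d - mdeg a)) (Poly_Mapping.lookup f a) :: 'k mpol)
      = Poly_Mapping.single 0 (Poly_Mapping.lookup f a) *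
        (\<Prod>i\<in>Poly_Mapping.keys a. tvar i ^ Poly_Mapping.lookup a i) * tvar s ^ (d - mdeg a)"
      by (simp add: m s mult_single)
    moreover have "?u ^ d = ?u ^ (d - mdeg a) * ?u ^ mdeg a"
      using le by (simp flip: power_add)
    moreover have "(\<Prod>i\<in>Poly_Mapping.keys a. (to_fract (tvar i) / ?u) ^ Poly_Mapping.lookup a i)
      = (\<Prod>i\<in>Poly_Mapping.keys a. to_fract (tvar i) ^ Poly_Mapping.lookup a i) / ?u ^ mdeg a"
      by (simp add: power_divide prod_dividef mdeg_def power_sum)
    ultimately show ?thesis using u by (simp add: hom)
  qed
  then show ?thesis
    by (simp add: homogenize_def hom sum_distrib_left)
qed

section \<open>Toric sets and projective points\<close>

definition toric_set :: "nat \<Rightarrow> nat \<Rightarrow> (nat \<Rightarrow> nat vec) \<Rightarrow> 'k::field vec set" where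
  "toric_set n s v = {vec s (\<lambda>i. \<Prod>j<n. (x $ j) ^ (v i $ j)) | x.
     x \<in> carrier_vec n \<and> (\<forall>j<n. x $ j \<noteq> 0)}"

definition append_one :: "'k::field vec \<Rightarrow> 'k vec" where
  "append_one x = x @\<^sub>v vec 1 (\<lambda>_. 1)"

text \<open>A point of projective space is the set of its representatives.\<close>

definition proj_point :: "'k::field vec \<Rightarrow> 'k vec set" where
  "proj_point x = {c \<cdot>\<^sub>v x | c. c \<noteq> 0}"

definition proj_image :: "'k::field vec set \<Rightarrow> 'k vec set set" where
  "proj_image X = (\<lambda>x. proj_point (append_one x)) ` X"

text \<open>\<open>Y\<close> is a set of points of projective \<open>s\<close>-space, and the ideal lives in \<open>s + 1\<close> variables.\<close>

definition vanishing_ideal :: "nat \<Rightarrow> 'k::field vec set set \<Rightarrow> 'k mpol set" where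
  "vanishing_ideal s Y = genideal (poly_alg (s + 1))
     {f. (\<exists>d. f \<in> polys_hom (s + 1) d) \<and> (\<forall>p\<in>Y. \<forall>x\<in>p. peval f x = 0)}"

section \<open>Codes\<close>

definition affine_word :: "nat \<Rightarrow> (nat \<Rightarrow> 'k::field vec) \<Rightarrow> 'k mpol \<Rightarrow> 'k vec" where
  "affine_word m P f = vec m (\<lambda>i. peval f (P i))"

definition affine_code :: "nat \<Rightarrow> nat \<Rightarrow> nat \<Rightarrow> (nat \<Rightarrow> 'k::field vec) \<Rightarrow> 'k vec set" where
  "affine_code s d m P = affine_word m P ` polys_le s d"

definition projective_word ::
    "nat \<Rightarrow> (nat \<Rightarrow> 'k::field vec) \<Rightarrow> 'k mpol \<Rightarrow> 'k mpol \<Rightarrow> 'k vec" where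
  "projective_word m Q f\<^sub>0 f = vec m (\<lambda>i. peval f (Q i) / peval f\<^sub>0 (Q i))"

definition projective_code :: "nat \<Rightarrow> nat \<Rightarrow> nat \<Rightarrow> (nat \<Rightarrow> 'k::field vec) \<Rightarrow> 'k vec set" where
  "projective_code s d m Q = projective_word m Q (tvar 0 ^ d) ` polys_hom (s + 1) d"

text \<open>The length is well defined for a nonempty set of words, in particular for a linear code.\<close>

definition code_length :: "'k::field vec set \<Rightarrow> nat" where
  "code_length C = (THE m. C \<subseteq> carrier_vec m)"

definition code_space :: "'k::field vec set \<Rightarrow> ('k, 'k vec) module" where
  "code_space C = (module_vec TYPE('k) (code_length C))\<lparr>carrier := C\<rparr>"

definition code_dim :: "'k::field vec set \<Rightarrow> nat" where
  "code_dim C = vectorspace.dim class_ring (code_space C)"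

definition hamming_weight :: "'k::field vec \<Rightarrow> nat" where
  "hamming_weight c = card {i. i < dim_vec c \<and> c $ i \<noteq> 0}"

definition min_distance :: "'k::field vec set \<Rightarrow> nat" where
  "min_distance C = Min (hamming_weight ` (C - {0\<^sub>v (code_length C)}))"

section \<open>Hilbert function, Krull dimension and degree\<close>

definition quot_module :: "('a, 'b, 'c) module_scheme \<Rightarrow> 'b set \<Rightarrow> ('a, 'b set) module" where
  "quot_module V W = \<lparr>carrier = a_rcosets\<^bsub>V\<^esub> W, mult = undefined, one = undefined,
     zero = W, add = set_add V, smult = (\<lambda>c A. \<Union>x\<in>A. W +>\<^bsub>V\<^esub> (c \<odot>\<^bsub>V\<^esub> x))\<rparr>"

text \<open>
  Below, \<open>r\<close> is the number of variables and \<open>I\<close> a homogeneous ideal of the polynomial ring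
  in \<open>r\<close> variables.
\<close>

definition hilbert_fun :: "nat \<Rightarrow> 'k::field mpol set \<Rightarrow> nat \<Rightarrow> nat" where
  "hilbert_fun r I d = vectorspace.dim class_ring
     (quot_module ((poly_alg r)\<lparr>carrier := polys_hom r d\<rparr>) (I \<inter> polys_hom r d))"

definition hilbert_poly :: "nat \<Rightarrow> 'k::field mpol set \<Rightarrow> rat poly" where
  "hilbert_poly r I = (THE h. \<exists>N. \<forall>d\<ge>N. poly h (of_nat d) = of_nat (hilbert_fun r I d))"

definition krull_dim :: "('a, 'b) ring_scheme \<Rightarrow> enat" where
  "krull_dim R = Sup {enat l | l. \<exists>p :: nat \<Rightarrow> 'a set.
     (\<forall>i\<le>l. primeideal (p i) R) \<and> (\<forall>i<l. p i \<subset> p (Suc i))}"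

text \<open>
  The formula assumes that the Krull dimension is positive, which holds for the coordinate ring of
  a nonempty set of projective points.
\<close>

definition quot_degree :: "nat \<Rightarrow> 'k::field mpol set \<Rightarrow> rat" where
  "quot_degree r I = (let k = the_enat (krull_dim (poly_alg r Quot I))
     in coeff (hilbert_poly r I) (k - 1) * fact (k - 1))"

end

(* A prime q of S[u] containing I(Y) contains, for some point P_k of X, all the linear forms
   t_i - P_ki u: otherwise, choosing for each k such a form outside q, their product would vanish
   on Y, hence lie in I(Y) and in q. Modulo these forms every polynomial is congruent to one in u
   alone, so chains of primes above I(Y) restrict to chains of primes in the principal ideal domain
   K[u]. Hence the Krull dimension is one and the degree is the constant term of the Hilbert
   polynomial. Evaluation at the points identifies S[u]_d / I(Y)_d with C_Y(d), which by
   interpolation is all of K^m for large d. *)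

theory Submission
  imports Defs "Jordan_Normal_Form.Char_Poly"
begin

text \<open>Parts (a) and (b) have one source. The last coordinate of (P_i,1) is 1, so f and its
  homogenization agree at the points, and the isomorphism is the diagonal map dividing the i-th
  entry by f_0(P_i). Points of a toric set have nonzero coordinates, so this map is invertible and
  preserves supports, hence weights. For (c) the obstacle is that I(Y) is known only through
  generators. It is bounded from above by kernels of evaluations, which are ideals containing the
  generators. Evaluation at (P_i,1) with values in K settles its degree-d part. The substitution t_i
  -> P_ki u with values in K[u] yields a prime above I(Y), and the same substitution picks the
  representative in u of a polynomial modulo the linear forms of P_k.\<close>

section \<open>Evaluating polynomials\<close>

text \<open>Evaluation with values in any ring, since \<open>peval\<close> stays in K: below,
  multiples of u are also substituted for the variables, both in \<open>'k poly\<close> and in S[u].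
  The map \<open>\<phi>\<close> carries the coefficients over.\<close>

definition insertion :: "('k::comm_ring_1 \<Rightarrow> 'b::comm_ring_1) \<Rightarrow> (nat \<Rightarrow> 'b) \<Rightarrow> 'k mpol \<Rightarrow> 'b" where
  "insertion \<phi> x f = (\<Sum>a\<in>Poly_Mapping.keys f. \<phi> (Poly_Mapping.lookup f a) *
     (\<Prod>i\<in>Poly_Mapping.keys a. x i ^ Poly_Mapping.lookup a i))"

lemma peval_eq_insertion: "peval f x = insertion id (\<lambda>i. x $ i) f"
  by (simp add: peval_def insertion_def)

lemma monomial_prod_superset:
  fixes x :: "nat \<Rightarrow> 'b::comm_monoid_mult"
  assumes "finite A" "Poly_Mapping.keys a \<subseteq> A"
  shows "(\<Prod>i\<in>Poly_Mapping.keys a. x i ^ Poly_Mapping.lookup a i) =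
    (\<Prod>i\<in>A. x i ^ Poly_Mapping.lookup a i)"
  using assms by (intro prod.mono_neutral_left) (auto simp: in_keys_iff)

lemma monomial_prod_add:
  fixes x :: "nat \<Rightarrow> 'b::comm_monoid_mult"
  shows "(\<Prod>i\<in>Poly_Mapping.keys (a + b). x i ^ Poly_Mapping.lookup (a + b) i) =
    (\<Prod>i\<in>Poly_Mapping.keys a. x i ^ Poly_Mapping.lookup a i) *
    (\<Prod>i\<in>Poly_Mapping.keys b. x i ^ Poly_Mapping.lookup b i)"
proof -
  let ?A = "Poly_Mapping.keys a \<union> Poly_Mapping.keys b"
  have "(\<Prod>i\<in>Poly_Mapping.keys (a + b). x i ^ Poly_Mapping.lookup (a + b) i) =
      (\<Prod>i\<in>?A. x i ^ Poly_Mapping.lookup (a + b) i)"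
    using keys_add[of a b] by (intro monomial_prod_superset) auto
  also have "\<dots> = (\<Prod>i\<in>?A. x i ^ Poly_Mapping.lookup a i) * (\<Prod>i\<in>?A. x i ^ Poly_Mapping.lookup b i)"
    by (simp add: lookup_add power_add prod.distrib)
  finally show ?thesis
    by (simp add: monomial_prod_superset[of ?A a] monomial_prod_superset[of ?A b])
qed

lemma mdeg_eq_sum:
  assumes "finite A" "Poly_Mapping.keys a \<subseteq> A"
  shows "mdeg a = (\<Sum>i\<in>A. Poly_Mapping.lookup a i)"
  unfolding mdeg_def using assms by (intro sum.mono_neutral_left) (auto simp: in_keys_iff)

lemma mdeg_add: "mdeg (a + b) = mdeg a + mdeg b"
proof -
  let ?A = "Poly_Mapping.keys a \<union> Poly_Mapping.keys b"
  have "mdeg (a + b) = (\<Sum>i\<in>?A. Poly_Mapping.lookup (a + b) i)"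
    using keys_add[of a b] by (intro mdeg_eq_sum) auto
  then show ?thesis
    by (simp add: lookup_add sum.distrib mdeg_eq_sum[of ?A a] mdeg_eq_sum[of ?A b])
qed

lemma mdeg_zero [simp]: "mdeg 0 = 0"
  by (simp add: mdeg_def)

lemma mdeg_single [simp]: "mdeg (Poly_Mapping.single i e) = e"
  by (simp add: mdeg_def)

lemma mpol_sum_single:
  "f = (\<Sum>a\<in>Poly_Mapping.keys f. Poly_Mapping.single a (Poly_Mapping.lookup f a))"
  for f :: "'a \<Rightarrow>\<^sub>0 'k::comm_monoid_add"
  by (rule poly_mapping_eqI) (simp add: lookup_sum lookup_single when_def in_keys_iff)

context comm_ring_hom
begin

lemma insertion_superset:
  assumes "finite A" "Poly_Mapping.keys f \<subseteq> A"
  shows "insertion hom x f = (\<Sum>a\<in>A. hom (Poly_Mapping.lookup f a) *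
     (\<Prod>i\<in>Poly_Mapping.keys a. x i ^ Poly_Mapping.lookup a i))"
  unfolding insertion_def using assms by (intro sum.mono_neutral_left) (auto simp: in_keys_iff)

lemma insertion_zero [simp]: "insertion hom x 0 = 0"
  by (simp add: insertion_def)

lemma insertion_add: "insertion hom x (f + g) = insertion hom x f + insertion hom x g"
proof -
  let ?A = "Poly_Mapping.keys f \<union> Poly_Mapping.keys g"
  have "insertion hom x (f + g) = (\<Sum>a\<in>?A. hom (Poly_Mapping.lookup (f + g) a) *
     (\<Prod>i\<in>Poly_Mapping.keys a. x i ^ Poly_Mapping.lookup a i))"
    using keys_add[of f g] by (intro insertion_superset) auto
  then show ?thesis
    by (simp add: lookup_add hom_add ring_distribs sum.distrib
        insertion_superset[of ?A f] insertion_superset[of ?A g])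
qed

lemma insertion_single:
  "insertion hom x (Poly_Mapping.single a c) =
    hom c * (\<Prod>i\<in>Poly_Mapping.keys a. x i ^ Poly_Mapping.lookup a i)"
  by (simp add: insertion_superset[of "{a}"])

lemma insertion_sum: "insertion hom x (\<Sum>i\<in>A. f i) = (\<Sum>i\<in>A. insertion hom x (f i))"
  by (induction A rule: infinite_finite_induct) (simp_all add: insertion_add)

text \<open>Both factors are expanded into monomials; bilinearity leaves the product of two
  monomials, where exponents add.\<close>

lemma insertion_mult: "insertion hom x (f * g) = insertion hom x f * insertion hom x g"
proof -
  have mono: "insertion hom x (Poly_Mapping.single a c * Poly_Mapping.single b e) =
      insertion hom x (Poly_Mapping.single a c) * insertion hom x (Poly_Mapping.single b e)" for a b c e
    by (simp add: mult_single insertion_single monomial_prod_add hom_mult)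
  let ?S = "\<lambda>f. \<Sum>a\<in>Poly_Mapping.keys f. Poly_Mapping.single a (Poly_Mapping.lookup f a)"
  have "insertion hom x (?S f * ?S g) = insertion hom x (?S f) * insertion hom x (?S g)"
    by (simp add: sum_product insertion_sum mono)
  then show ?thesis
    by (simp flip: mpol_sum_single)
qed

lemma insertion_const [simp]: "insertion hom x (Poly_Mapping.single 0 c) = hom c"
  by (simp add: insertion_single)

lemma insertion_one [simp]: "insertion hom x 1 = 1"
  using insertion_const[of x 1] by simp

lemma insertion_tvar [simp]: "insertion hom x (tvar i) = x i"
  by (simp add: tvar_def insertion_single)

lemma insertion_comm_ring_hom: "comm_ring_hom (insertion hom x)"
  by unfold_locales (simp_all add: insertion_add insertion_mult)

lemma insertion_comp:
  assumes "comm_ring_hom \<psi>"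
  shows "\<psi> (insertion hom x f) = insertion (\<psi> \<circ> hom) (\<psi> \<circ> x) f"
proof -
  interpret \<psi>: comm_ring_hom \<psi> by fact
  show ?thesis
    by (simp add: insertion_def \<psi>.hom_sum \<psi>.hom_prod \<psi>.hom_mult \<psi>.hom_power)
qed

text \<open>Each monomial of degree d yields the factor c^d. With c in K this compares
  representatives of a projective point; with c = u it restricts a form to a line through the
  origin.\<close>

lemma insertion_polys_hom_scale:
  assumes "f \<in> polys_hom r d"
  shows "insertion hom (\<lambda>i. c * x i) f = c ^ d * insertion hom x f"
  unfolding insertion_def sum_distrib_left
  using assms by (intro sum.cong)
    (auto simp: polys_hom_def mdeg_def power_mult_distrib prod.distrib power_sum)

end

lemma insertion_cong:
  assumes "f \<in> polys r" "\<And>i. i < r \<Longrightarrow> x i = y i"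
  shows "insertion \<phi> x f = insertion \<phi> y f"
  unfolding insertion_def using assms(1)
  by (intro sum.cong prod.cong arg_cong2[where f = "(*)"] refl)
    (auto simp: polys_def intro!: arg_cong2[where f = "(^)"] assms(2))

interpretation id_hom: comm_ring_hom "id :: 'k \<Rightarrow> 'k::comm_ring_1"
  by unfold_locales auto

interpretation mpol_const: comm_ring_hom "Poly_Mapping.single 0 :: 'k \<Rightarrow> 'k::comm_ring_1 mpol"
  by unfold_locales (auto simp: single_add mult_single)

interpretation poly_const: comm_ring_hom "\<lambda>c::'k::comm_ring_1. [:c:]"
  by unfold_locales (auto simp: one_pCons)

interpretation peval: comm_ring_hom "\<lambda>f::'k::comm_ring_1 mpol. peval f x"
  unfolding peval_eq_insertion by (rule id_hom.insertion_comm_ring_hom)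

lemma peval_tvar [simp]: "peval (tvar i) x = x $ i"
  by (simp add: peval_eq_insertion)

lemma peval_const [simp]: "peval (Poly_Mapping.single 0 c) x = c"
  by (simp add: peval_eq_insertion)

lemma peval_single:
  "peval (Poly_Mapping.single a c) x = c * (\<Prod>i\<in>Poly_Mapping.keys a. (x $ i) ^ Poly_Mapping.lookup a i)"
  by (simp add: peval_eq_insertion id_hom.insertion_single)

lemma insertion_const_tvar: "insertion (Poly_Mapping.single 0) tvar f = f"
proof -
  have "insertion (Poly_Mapping.single 0) tvar f =
      (\<Sum>a\<in>Poly_Mapping.keys f. Poly_Mapping.single a (Poly_Mapping.lookup f a))"
    by (simp add: insertion_def prod_tvar_power sum_single_keys mult_single)
  then show ?thesis by (simp flip: mpol_sum_single)
qed

section \<open>Spaces of polynomials\<close>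

lemma polys_zero [simp]: "0 \<in> polys r" and polys_one [simp]: "1 \<in> polys r"
  by (auto simp: polys_def)

lemma polys_const [simp]: "Poly_Mapping.single 0 c \<in> polys r"
  by (simp add: polys_def)

lemma polys_tvar [simp]: "tvar i \<in> polys r" if "i < r"
  using that by (simp add: polys_def tvar_def)

lemma polys_add [simp]: "f \<in> polys r \<Longrightarrow> g \<in> polys r \<Longrightarrow> f + g \<in> polys r"
  using keys_add[of f g] by (auto simp: polys_def)

lemma keys_multE:
  assumes "a \<in> Poly_Mapping.keys (f * g)"
  obtains b c where "a = b + c" "b \<in> Poly_Mapping.keys f" "c \<in> Poly_Mapping.keys g"
  using assms subsetD[OF keys_mult] by blast

lemma polys_mult [simp]:
  assumes "f \<in> polys r" "g \<in> polys r"
  shows "f * g \<in> polys r"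
proof -
  have "Poly_Mapping.keys a \<subseteq> {..<r}" if "a \<in> Poly_Mapping.keys (f * g)" for a
  proof -
    from that obtain b c where "a = b + c" "b \<in> Poly_Mapping.keys f" "c \<in> Poly_Mapping.keys g"
      by (rule keys_multE)
    with assms show ?thesis using keys_add[of b c] unfolding polys_def by blast
  qed
  then show ?thesis by (simp add: polys_def)
qed

lemma polys_uminus [simp]: "- f \<in> polys r" if "f \<in> polys r"
  using polys_mult[OF polys_const[of "-1"] that] by (simp add: single_uminus)

lemma polys_diff [simp]: "f \<in> polys r \<Longrightarrow> g \<in> polys r \<Longrightarrow> f - g \<in> polys r"
  using polys_add[of f r "- g"] by simp

lemma polys_prod: "(\<And>i. i \<in> A \<Longrightarrow> f i \<in> polys r) \<Longrightarrow> (\<Prod>i\<in>A. f i) \<in> polys r"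
  by (induction A rule: infinite_finite_induct) simp_all

text \<open>Constants and variables generate the algebra: \<open>insertion_const_tvar\<close> writes
  f as sums of products of them, and Q is followed through that expression.\<close>

lemma polys_induct [consumes 1, case_names const tvar add mult]:
  assumes f: "f \<in> polys r"
    and const: "\<And>c. Q (Poly_Mapping.single 0 c)"
    and tvar: "\<And>i. i < r \<Longrightarrow> Q (tvar i)"
    and add: "\<And>f g. f \<in> polys r \<Longrightarrow> g \<in> polys r \<Longrightarrow> Q f \<Longrightarrow> Q g \<Longrightarrow> Q (f + g)"
    and mult: "\<And>f g. f \<in> polys r \<Longrightarrow> g \<in> polys r \<Longrightarrow> Q f \<Longrightarrow> Q g \<Longrightarrow> Q (f * g)"
  shows "Q f"
proof -
  \<comment> \<open>Membership is carried along because the cases \<open>add\<close> and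
    \<open>mult\<close> ask for it.\<close>
  let ?Q = "\<lambda>f. f \<in> polys r \<and> Q f"
  have zero: "?Q 0" and one: "?Q 1" using const[of 0] const[of 1] by simp_all
  have pow: "?Q (tvar i ^ e)" if "i < r" for i e
    using that one by (induction e) (auto intro: mult tvar)
  have prod: "?Q (\<Prod>i\<in>A. tvar i ^ e i)" if "A \<subseteq> {..<r}" for A e
    using that one
  proof (induction A rule: infinite_finite_induct)
    case (insert i A)
    then show ?case using pow[of i "e i"] by (auto intro: mult)
  qed auto
  have sum: "?Q (\<Sum>a\<in>A. g a)" if "\<And>a. a \<in> A \<Longrightarrow> ?Q (g a)" for A :: "(nat \<Rightarrow>\<^sub>0 nat) set" and g
    using that zero by (induction A rule: infinite_finite_induct) (auto intro: add)
  have "?Q (insertion (Poly_Mapping.single 0) tvar f)"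
    unfolding insertion_def
  proof (rule sum)
    fix a assume "a \<in> Poly_Mapping.keys f"
    then have "Poly_Mapping.keys a \<subseteq> {..<r}" using f by (auto simp: polys_def)
    from prod[OF this] const show "?Q (Poly_Mapping.single 0 (Poly_Mapping.lookup f a) *
        (\<Prod>i\<in>Poly_Mapping.keys a. tvar i ^ Poly_Mapping.lookup a i))"
      by (auto intro: mult)
  qed
  then show ?thesis by (simp add: insertion_const_tvar)
qed

lemma polys_hom_subset: "polys_hom r d \<subseteq> polys r"
  by (auto simp: polys_hom_def)

lemma polys_hom_zero [simp]: "0 \<in> polys_hom r d"
  by (simp add: polys_hom_def)

lemma polys_hom_one [simp]: "1 \<in> polys_hom r 0"
  by (simp add: polys_hom_def)

lemma polys_hom_add [simp]: "f \<in> polys_hom r d \<Longrightarrow> g \<in> polys_hom r d \<Longrightarrow> f + g \<in> polys_hom r d"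
  using keys_add[of f g] by (auto simp: polys_hom_def)

lemma polys_hom_mult:
  "f \<in> polys_hom r d \<Longrightarrow> g \<in> polys_hom r e \<Longrightarrow> f * g \<in> polys_hom r (d + e)"
  unfolding polys_hom_def by (auto simp: mdeg_add elim!: keys_multE)

lemma polys_hom_const [simp]: "Poly_Mapping.single 0 c \<in> polys_hom r 0"
  by (simp add: polys_hom_def)

lemma polys_hom_tvar: "tvar i \<in> polys_hom r 1" if "i < r"
  using that by (simp add: polys_hom_def polys_def tvar_def)

lemma polys_hom_smult [simp]: "Poly_Mapping.single 0 c * f \<in> polys_hom r d" if "f \<in> polys_hom r d"
  using polys_hom_mult[OF polys_hom_const that] by simp

lemma polys_hom_diff: "f - g \<in> polys_hom r d" if "f \<in> polys_hom r d" "g \<in> polys_hom r d"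
  using polys_hom_add[OF that(1) polys_hom_smult[OF that(2), of "-1"]] by (simp add: single_uminus)

lemma polys_hom_prod: "(\<And>i. i \<in> A \<Longrightarrow> f i \<in> polys_hom r 1) \<Longrightarrow> (\<Prod>i\<in>A. f i) \<in> polys_hom r (card A)"
proof (induction A rule: infinite_finite_induct)
  case (insert i A)
  then show ?case using polys_hom_mult[of "f i" r 1 "\<Prod>i\<in>A. f i" "card A"] by simp
qed simp_all

lemma polys_hom_sum: "(\<And>i. i \<in> A \<Longrightarrow> f i \<in> polys_hom r d) \<Longrightarrow> (\<Sum>i\<in>A. f i) \<in> polys_hom r d"
  by (induction A rule: infinite_finite_induct) simp_all

lemma polys_le_zero [simp]: "0 \<in> polys_le r d"
  by (simp add: polys_le_def)

lemma polys_le_add [simp]: "f \<in> polys_le r d \<Longrightarrow> g \<in> polys_le r d \<Longrightarrow> f + g \<in> polys_le r d"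
  using keys_add[of f g] by (auto simp: polys_le_def)

lemma polys_le_mult: "f \<in> polys_le r d \<Longrightarrow> g \<in> polys_le r e \<Longrightarrow> f * g \<in> polys_le r (d + e)"
  unfolding polys_le_def by (auto simp: mdeg_add intro!: add_mono elim!: keys_multE)

lemma polys_le_mono: "f \<in> polys_le r d \<Longrightarrow> d \<le> e \<Longrightarrow> f \<in> polys_le r e"
  by (auto simp: polys_le_def)

lemma polys_le_const [simp]: "Poly_Mapping.single 0 c \<in> polys_le r d"
  by (simp add: polys_le_def)

lemma polys_le_one [simp]: "1 \<in> polys_le r d"
  by (simp add: polys_le_def polys_def)

lemma polys_le_tvar: "tvar i \<in> polys_le r 1" if "i < r"
  using that by (simp add: polys_le_def polys_def tvar_def)

lemma polys_le_smult [simp]: "Poly_Mapping.single 0 c * f \<in> polys_le r d" if "f \<in> polys_le r d"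
  using polys_le_mult[OF polys_le_const[of c r 0] that] by simp

lemma polys_le_prod: "(\<And>i. i \<in> A \<Longrightarrow> f i \<in> polys_le r 1) \<Longrightarrow> (\<Prod>i\<in>A. f i) \<in> polys_le r (card A)"
proof (induction A rule: infinite_finite_induct)
  case (insert i A)
  then show ?case using polys_le_mult[of "f i" r 1 "\<Prod>i\<in>A. f i" "card A"] by simp
qed simp_all

lemma polys_le_sum: "(\<And>i. i \<in> A \<Longrightarrow> f i \<in> polys_le r d) \<Longrightarrow> (\<Sum>i\<in>A. f i) \<in> polys_le r d"
  by (induction A rule: infinite_finite_induct) simp_all

section \<open>Homogenization\<close>

text \<open>The substitution u = 1, carried out on exponents.\<close>

definition dehomogenize :: "nat \<Rightarrow> 'k::comm_ring_1 mpol \<Rightarrow> 'k mpol" where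
  "dehomogenize s g = (\<Sum>a\<in>Poly_Mapping.keys g.
     Poly_Mapping.single (a - Poly_Mapping.single s (Poly_Mapping.lookup a s)) (Poly_Mapping.lookup g a))"

lemma index_append_one [simp]:
  "x \<in> carrier_vec s \<Longrightarrow> i < s \<Longrightarrow> append_one x $ i = x $ i"
  "x \<in> carrier_vec s \<Longrightarrow> append_one x $ s = 1"
  by (auto simp: append_one_def)

lemma append_one_carrier [simp]: "x \<in> carrier_vec s \<Longrightarrow> append_one x \<in> carrier_vec (s + 1)"
  unfolding append_one_def by (intro append_carrier_vec) auto

lemma polys_le_keysD:
  "f \<in> polys_le r d \<Longrightarrow> a \<in> Poly_Mapping.keys f \<Longrightarrow> Poly_Mapping.keys a \<subseteq> {..<r} \<and> mdeg a \<le> d"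
  by (auto simp: polys_le_def polys_def)

lemma polys_hom_keysD:
  "f \<in> polys_hom r d \<Longrightarrow> a \<in> Poly_Mapping.keys f \<Longrightarrow> Poly_Mapping.keys a \<subseteq> {..<r} \<and> mdeg a = d"
  by (auto simp: polys_hom_def polys_def)

lemma homogenize_in_polys_hom: "homogenize s d f \<in> polys_hom (s + 1) d" if "f \<in> polys_le s d"
  unfolding homogenize_def
proof (rule polys_hom_sum)
  fix a assume "a \<in> Poly_Mapping.keys f"
  then have a: "Poly_Mapping.keys a \<subseteq> {..<s}" "mdeg a \<le> d"
    using polys_le_keysD[OF that] by auto
  let ?b = "a + Poly_Mapping.single s (d - mdeg a)"
  have "Poly_Mapping.keys ?b \<subseteq> {..<s + 1}"
    using a keys_add[of a "Poly_Mapping.single s (d - mdeg a)"]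
    by (force split: if_splits)
  moreover have "mdeg ?b = d" using a by (simp add: mdeg_add)
  ultimately show "Poly_Mapping.single ?b (Poly_Mapping.lookup f a) \<in> polys_hom (s + 1) d"
    by (simp add: polys_hom_def polys_def)
qed

text \<open>The added power of u is evaluated at the last coordinate, which is 1.\<close>

lemma peval_homogenize:
  assumes f: "f \<in> polys_le s d" and x: "x \<in> carrier_vec s"
  shows "peval (homogenize s d f) (append_one x) = peval f x"
proof -
  have "(\<Prod>i\<in>Poly_Mapping.keys a. append_one x $ i ^ Poly_Mapping.lookup a i) =
      (\<Prod>i\<in>Poly_Mapping.keys a. x $ i ^ Poly_Mapping.lookup a i)" if "a \<in> Poly_Mapping.keys f" for a
    using polys_le_keysD[OF f that] x by (intro prod.cong) auto
  moreover have "append_one x $ s = 1" using x by simp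
  ultimately show ?thesis
    unfolding homogenize_def peval.hom_sum peval_single monomial_prod_add peval_def[of f]
    by (intro sum.cong) simp_all
qed

text \<open>Provides preimages for surjectivity onto the projective code. A word depends only on
  values at the points, so values are compared, not polynomials.\<close>

lemma dehomogenize:
  assumes g: "g \<in> polys_hom (s + 1) d"
  shows dehomogenize_in_polys_le: "dehomogenize s g \<in> polys_le s d"
    and peval_dehomogenize: "x \<in> carrier_vec s \<Longrightarrow> peval (dehomogenize s g) x = peval g (append_one x)"
proof -
  let ?b = "\<lambda>a :: nat \<Rightarrow>\<^sub>0 nat. a - Poly_Mapping.single s (Poly_Mapping.lookup a s)"
  have lookup_b: "Poly_Mapping.lookup (?b a) i = (if i = s then 0 else Poly_Mapping.lookup a i)" for a i
    by (simp add: lookup_minus lookup_single when_def)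
  have a: "?b a + Poly_Mapping.single s (Poly_Mapping.lookup a s) = a" for a
    by (rule poly_mapping_eqI) (simp add: lookup_add lookup_b lookup_single when_def)
  have keys_b: "Poly_Mapping.keys (?b a) \<subseteq> {..<s}" if "a \<in> Poly_Mapping.keys g" for a
  proof
    fix i assume "i \<in> Poly_Mapping.keys (?b a)"
    then have "i \<noteq> s" "i \<in> Poly_Mapping.keys a"
      by (simp_all add: in_keys_iff lookup_b split: if_splits)
    with polys_hom_keysD[OF g that] show "i \<in> {..<s}" by auto
  qed
  \<comment> \<open>Degrees are compared in the identity that gives the removed power of u
    back.\<close>
  have "mdeg (?b a) \<le> d" if "a \<in> Poly_Mapping.keys g" for a
    using arg_cong[OF a[of a], of mdeg] polys_hom_keysD[OF g that] by (simp add: mdeg_add)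
  with keys_b show "dehomogenize s g \<in> polys_le s d"
    unfolding dehomogenize_def by (intro polys_le_sum) (auto simp: polys_le_def polys_def)
  assume x: "x \<in> carrier_vec s"
  have one_s: "append_one x $ s = 1" using x by simp
  have "(\<Prod>i\<in>Poly_Mapping.keys a. append_one x $ i ^ Poly_Mapping.lookup a i) =
      (\<Prod>i\<in>Poly_Mapping.keys (?b a). x $ i ^ Poly_Mapping.lookup (?b a) i)"
    if "a \<in> Poly_Mapping.keys g" for a
  proof -
    have "(\<Prod>i\<in>Poly_Mapping.keys a. append_one x $ i ^ Poly_Mapping.lookup a i) =
        (\<Prod>i\<in>Poly_Mapping.keys (?b a). append_one x $ i ^ Poly_Mapping.lookup (?b a) i)"
      using monomial_prod_add[where x = "\<lambda>i. append_one x $ i" and a = "?b a"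
          and b = "Poly_Mapping.single s (Poly_Mapping.lookup a s)"] x by (simp add: a one_s)
    also have "\<dots> = (\<Prod>i\<in>Poly_Mapping.keys (?b a). x $ i ^ Poly_Mapping.lookup (?b a) i)"
      using keys_b[OF that] x by (intro prod.cong) auto
    finally show ?thesis .
  qed
  then show "peval (dehomogenize s g) x = peval g (append_one x)"
    unfolding dehomogenize_def peval.hom_sum peval_single peval_def[of g]
    by (intro sum.cong) simp_all
qed

section \<open>Quotient spaces and linear maps\<close>

text \<open>The axioms are equations between elements of V, so they may be checked after applying
  the injective f. This covers codes inside K^m (f is the inclusion) and quotients (f is the induced
  map).\<close>

lemma vectorspace_pullback:
  assumes W: "vectorspace K W"
    and f: "f \<in> carrier V \<rightarrow> carrier W" "inj_on f (carrier V)"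
    and zero: "\<zero>\<^bsub>V\<^esub> \<in> carrier V" "f \<zero>\<^bsub>V\<^esub> = \<zero>\<^bsub>W\<^esub>"
    and add: "\<And>x y. x \<in> carrier V \<Longrightarrow> y \<in> carrier V \<Longrightarrow> x \<oplus>\<^bsub>V\<^esub> y \<in> carrier V"
      "\<And>x y. x \<in> carrier V \<Longrightarrow> y \<in> carrier V \<Longrightarrow> f (x \<oplus>\<^bsub>V\<^esub> y) = f x \<oplus>\<^bsub>W\<^esub> f y"
    and smult: "\<And>c x. c \<in> carrier K \<Longrightarrow> x \<in> carrier V \<Longrightarrow> c \<odot>\<^bsub>V\<^esub> x \<in> carrier V"
      "\<And>c x. c \<in> carrier K \<Longrightarrow> x \<in> carrier V \<Longrightarrow> f (c \<odot>\<^bsub>V\<^esub> x) = c \<odot>\<^bsub>W\<^esub> f x"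
  shows "vectorspace K V" and "linear_map K V W f"
proof -
  interpret W: vectorspace K W by fact
  have fc [simp]: "x \<in> carrier V \<Longrightarrow> f x \<in> carrier W" for x using f by auto
  note [simp] = zero add smult
  have eqI: "x = y" if "f x = f y" "x \<in> carrier V" "y \<in> carrier V" for x y
    using f(2) that by (auto dest: inj_onD)
  have neg: "\<exists>w\<in>carrier V. v \<oplus>\<^bsub>V\<^esub> w = \<zero>\<^bsub>V\<^esub>" if "v \<in> carrier V" for v
  proof (intro bexI eqI)
    \<comment> \<open>V is not yet known to be a group; the negative comes from closure under
      scalars.\<close>
    let ?w = "(\<ominus>\<^bsub>K\<^esub> \<one>\<^bsub>K\<^esub>) \<odot>\<^bsub>V\<^esub> v"
    show "f (v \<oplus>\<^bsub>V\<^esub> ?w) = f \<zero>\<^bsub>V\<^esub>"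
      using that by (simp add: W.smult_minus_1 W.M.r_neg)
  qed (use that in simp_all)
  show V: "vectorspace K V"
  proof (rule vs_criteria)
    show "field K" by (rule W.field_axioms)
  qed (auto intro!: eqI intro: neg simp: W.M.a_ac W.smult_assoc1 W.smult_l_distr W.smult_r_distr)
  show "linear_map K V W f"
    using V W by (auto simp: linear_map_def mod_hom_def mod_hom_axioms_def module_hom_def vectorspace_def)
qed

text \<open>First isomorphism theorem. T is constant on each coset of its kernel, so the image of a
  coset is a singleton and \<open>the_elem\<close> reads off its value.\<close>

lemma (in linear_map)
  assumes surj: "T ` carrier V = carrier W"
  shows quot_module_linear_map: "linear_map K (quot_module V kerT) W (\<lambda>A. the_elem (T ` A))"
    and quot_module_bij_betw:
      "bij_betw (\<lambda>A. the_elem (T ` A)) (carrier (quot_module V kerT)) (carrier W)"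
proof -
  have Vg: "abelian_group V" and Wg: "abelian_group W"
    using V.vectorspace_axioms W.vectorspace_axioms by (simp_all add: vectorspace_def module_def)
  note group = abelian_group.r_neg[OF Vg] abelian_group.l_neg[OF Vg] abelian_group.r_neg[OF Wg]
    abelian_group.r_neg1[OF Vg] abelian_group.r_neg1[OF Wg] abelian_group.a_inv_closed[OF Vg]
    abelian_group.a_inv_closed[OF Wg] a_minus_def
  note assoc = abelian_monoid.a_assoc[OF abelian_group.axioms(1)[OF Vg]]
    abelian_monoid.a_assoc[OF abelian_group.axioms(1)[OF Wg]]
  note comm = abelian_monoid.a_comm[OF abelian_group.axioms(1)[OF Vg]]
    abelian_monoid.a_comm[OF abelian_group.axioms(1)[OF Wg]]
  note lcomm = abelian_monoid.a_lcomm[OF abelian_group.axioms(1)[OF Vg]]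
    abelian_monoid.a_lcomm[OF abelian_group.axioms(1)[OF Wg]]
  \<comment> \<open>Cosets of the kernel are the fibres of T. Indexing them by their value in W
    makes the operations on cosets computable there.\<close>
  define fib where "fib w = {y \<in> carrier V. T y = w}" for w
  have coset: "kerT +>\<^bsub>V\<^esub> x = fib (T x)" if x: "x \<in> carrier V" for x
  proof
    show "kerT +>\<^bsub>V\<^esub> x \<subseteq> fib (T x)"
      using x by (auto simp: a_r_coset_def' ker_def fib_def)
    show "fib (T x) \<subseteq> kerT +>\<^bsub>V\<^esub> x"
    proof
      fix y assume "y \<in> fib (T x)"
      then have y: "y \<in> carrier V" "T y = T x" by (auto simp: fib_def)
      then have "y \<ominus>\<^bsub>V\<^esub> x \<in> kerT" "y = (y \<ominus>\<^bsub>V\<^esub> x) \<oplus>\<^bsub>V\<^esub> x"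
        using x by (simp_all add: ker_def T_minus T_neg group assoc)
      then show "y \<in> kerT +>\<^bsub>V\<^esub> x" by (auto simp: a_r_coset_def')
    qed
  qed
  have carrier: "carrier (quot_module V kerT) = fib ` carrier W"
    unfolding quot_module_def A_RCOSETS_def' surj[symmetric]
    by (auto simp: coset)
  have fib: "the_elem (T ` fib w) = w" if w: "w \<in> carrier W" for w
  proof -
    obtain x where "x \<in> carrier V" "w = T x" using w unfolding surj[symmetric] by auto
    then have "T ` fib w = {w}" by (auto simp: fib_def)
    then show ?thesis by simp
  qed
  have zero: "\<zero>\<^bsub>quot_module V kerT\<^esub> = fib \<zero>\<^bsub>W\<^esub>"
    by (simp add: quot_module_def ker_def fib_def)
  have add: "fib w \<oplus>\<^bsub>quot_module V kerT\<^esub> fib z = fib (w \<oplus>\<^bsub>W\<^esub> z)"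
    if "w \<in> carrier W" "z \<in> carrier W" for w z
  proof -
    obtain a b where ab: "a \<in> carrier V" "w = T a" "b \<in> carrier V" "z = T b"
      using \<open>w \<in> _\<close> \<open>z \<in> _\<close> unfolding surj[symmetric] by auto
    have "y \<in> (\<Union>h\<in>fib w. \<Union>k\<in>fib z. {h \<oplus>\<^bsub>V\<^esub> k})" if y: "y \<in> fib (w \<oplus>\<^bsub>W\<^esub> z)" for y
    proof -
      have y: "y \<in> carrier V" "T y = T a \<oplus>\<^bsub>W\<^esub> T b" using y ab by (auto simp: fib_def)
      \<comment> \<open>A sum of cosets is a set of sums, so y must be split explicitly: a lies over
        w, and the rest lies over z.\<close>
      have "y = a \<oplus>\<^bsub>V\<^esub> (y \<ominus>\<^bsub>V\<^esub> a)"
        using y ab by (simp add: group lcomm(1)[of a y])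
      moreover have "y \<ominus>\<^bsub>V\<^esub> a \<in> fib z"
        using y ab by (simp add: fib_def T_minus T_neg group assoc comm(2)[of "T a" "T b"])
      moreover have "a \<in> fib w" using ab by (simp add: fib_def)
      ultimately show ?thesis by blast
    qed
    then show ?thesis
      by (auto simp: quot_module_def set_add_def' fib_def)
  qed
  have smult: "c \<odot>\<^bsub>quot_module V kerT\<^esub> fib w = fib (c \<odot>\<^bsub>W\<^esub> w)"
    if "w \<in> carrier W" "c \<in> carrier K" for c w
  proof -
    obtain a where "a \<in> carrier V" "w = T a" using \<open>w \<in> _\<close> unfolding surj[symmetric] by auto
    \<comment> \<open>The scalar multiple of a coset is a union over its elements. All its members
      agree, but over an empty fibre the union would be empty.\<close>
    then have "fib w \<noteq> {}" by (auto simp: fib_def)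
    moreover have "kerT +>\<^bsub>V\<^esub> (c \<odot>\<^bsub>V\<^esub> y) = fib (c \<odot>\<^bsub>W\<^esub> w)" if "y \<in> fib w" for y
      using that \<open>c \<in> _\<close> by (auto simp: fib_def coset T_smult)
    ultimately show ?thesis by (auto simp: quot_module_def)
  qed
  have inj: "inj_on (\<lambda>A. the_elem (T ` A)) (carrier (quot_module V kerT))"
    unfolding carrier by (rule inj_onI) (auto simp: fib)
  have f: "(\<lambda>A. the_elem (T ` A)) \<in> carrier (quot_module V kerT) \<rightarrow> carrier W"
    by (auto simp: carrier fib)
  show "linear_map K (quot_module V kerT) W (\<lambda>A. the_elem (T ` A))"
    by (rule vectorspace_pullback(2)[OF W.vectorspace_axioms f inj])
      (auto simp: carrier zero add smult fib)
  show "bij_betw (\<lambda>A. the_elem (T ` A)) (carrier (quot_module V kerT)) (carrier W)"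
    using inj by (auto simp: bij_betw_def carrier fib image_image)
qed

lemma (in vectorspace) finite_imp_fin_dim: "finite (carrier V) \<Longrightarrow> fin_dim"
  unfolding fin_dim_def by (intro exI[of _ "carrier V"]) (simp add: in_own_span span_is_subset2 subset_antisym)

text \<open>Finite dimension is obtained from finiteness of the set W, which the bijection transfers
  to V.\<close>

lemma (in linear_map) dim_eq_of_bij_betw:
  assumes "bij_betw T (carrier V) (carrier W)" "finite (carrier W)"
  shows "vectorspace.dim K V = vectorspace.dim K W"
  using assms bij_betw_finite[OF assms(1)]
  by (intro dim_eq V.finite_imp_fin_dim) (auto simp: bij_betw_def)

lemma (in linear_map) dim_quot_module:
  assumes surj: "T ` carrier V = carrier W" and fin: "finite (carrier W)"
  shows "vectorspace.dim K (quot_module V kerT) = W.dim"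
proof -
  interpret Q: linear_map K "quot_module V kerT" W "\<lambda>A. the_elem (T ` A)"
    by (rule quot_module_linear_map[OF surj])
  show ?thesis
    by (rule Q.dim_eq_of_bij_betw[OF quot_module_bij_betw[OF surj] fin])
qed

section \<open>Code spaces\<close>

lemma code_length_eq: "code_length C = m" if "C \<subseteq> carrier_vec m" "C \<noteq> {}"
  unfolding code_length_def
proof (rule the_equality)
  obtain x where "x \<in> C" using \<open>C \<noteq> {}\<close> by blast
  then show "k = m" if "C \<subseteq> carrier_vec k" for k
    using that \<open>C \<subseteq> carrier_vec m\<close> by (metis carrier_vecD subsetD)
qed fact

lemma vectorspace_code_space:
  fixes C :: "'k::field vec set"
  assumes "C \<subseteq> carrier_vec m" "0\<^sub>v m \<in> C"
    and "\<And>x y. x \<in> C \<Longrightarrow> y \<in> C \<Longrightarrow> x + y \<in> C" "\<And>c x. x \<in> C \<Longrightarrow> c \<cdot>\<^sub>v x \<in> C"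
  shows "vectorspace class_ring (code_space C)"
proof -
  \<comment> \<open>The zero of \<open>code_space C\<close> has length \<open>code_length C\<close>,
    so this length comes first.\<close>
  have "code_length C = m" using assms(1,2) by (intro code_length_eq) auto
  with assms show ?thesis
    by (intro vectorspace_pullback(1)[OF vec_vs[of m], where f = "\<lambda>x. x"])
      (auto simp: code_space_def module_vec_simps)
qed

lemma code_space_simps [simp]:
  "carrier (code_space C) = C" "add (code_space C) = (+)" "module.smult (code_space C) = (\<cdot>\<^sub>v)"
  by (simp_all add: code_space_def module_vec_simps)

lemma code_dim_carrier_vec [simp]: "code_dim (carrier_vec m :: 'k::field vec set) = m"
proof -
  have "code_length (carrier_vec m :: 'k vec set) = m"
    by (rule code_length_eq, simp, use zero_carrier_vec in blast)
  moreover have "(module_vec TYPE('k) m)\<lparr>carrier := carrier_vec m\<rparr> = module_vec TYPE('k) m"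
    by (simp add: module_vec_def)
  ultimately show ?thesis
    by (simp add: code_dim_def code_space_def vec_space.dim_is_n)
qed

section \<open>The polynomial ring and the vanishing ideal\<close>

lemma poly_alg_simps [simp]:
  "carrier (poly_alg r) = polys r" "monoid.mult (poly_alg r) = (*)" "one (poly_alg r) = 1"
  "zero (poly_alg r) = 0" "add (poly_alg r) = (+)"
  "module.smult (poly_alg r) = (\<lambda>c f. Poly_Mapping.single 0 c * f)"
  by (simp_all add: poly_alg_def)

lemma cring_poly_alg: "cring (poly_alg r :: ('k::comm_ring_1, 'k mpol) module)"
proof (rule cringI)
  show "abelian_group (poly_alg r :: ('k, 'k mpol) module)"
    by (rule abelian_groupI) (auto simp: add_ac intro: bexI[of _ "- x" for x])
  show "comm_monoid (poly_alg r :: ('k, 'k mpol) module)"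
    by (rule comm_monoidI) (auto simp: mult_ac)
qed (simp_all add: ring_distribs)

lemma primeideal_poly_alg:
  fixes q :: "'k::comm_ring_1 mpol set"
  assumes q: "primeideal q (poly_alg r)"
  shows "0 \<in> q" "a \<in> q \<Longrightarrow> b \<in> q \<Longrightarrow> a + b \<in> q" "a \<in> q \<Longrightarrow> b \<in> polys r \<Longrightarrow> b * a \<in> q"
    and "a \<in> q \<Longrightarrow> a \<in> polys r" "1 \<notin> q"
    and "a \<in> polys r \<Longrightarrow> b \<in> polys r \<Longrightarrow> a * b \<in> q \<Longrightarrow> a \<in> q \<or> b \<in> q"
proof -
  have i: "ideal q (poly_alg r)" by (rule primeideal.axioms(1)[OF q])
  have a: "additive_subgroup q (poly_alg r)" by (rule ideal.axioms(1)[OF i])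
  show "0 \<in> q" using additive_subgroup.zero_closed[OF a] by simp
  show "a + b \<in> q" if "a \<in> q" "b \<in> q"
    using additive_subgroup.a_closed[OF a] that by simp
  show "b * a \<in> q" if "a \<in> q" "b \<in> polys r"
    using ideal.I_l_closed[OF i] that by simp
  show "a \<in> polys r" if "a \<in> q"
    using ideal.Icarr[OF i] that by simp
  show "1 \<notin> q"
    using ideal.one_imp_carrier[OF i] primeideal.I_notcarr[OF q] by auto
  show "a \<in> q \<or> b \<in> q" if "a \<in> polys r" "b \<in> polys r" "a * b \<in> q"
    using primeideal.I_prime[OF q] that by simp
qed

text \<open>The target is an integral domain. Every concrete prime or upper bound for I(Y) below is
  such a kernel, with values in K or in K[u].\<close>

lemma primeideal_insertion_kernel:
  fixes \<phi> :: "'k::comm_ring_1 \<Rightarrow> 'b::idom"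
  assumes "comm_ring_hom \<phi>"
  shows "primeideal {f \<in> polys r. insertion \<phi> x f = 0} (poly_alg r)"
proof -
  interpret comm_ring_hom \<phi> by fact
  interpret R: cring "poly_alg r :: ('k, 'k mpol) module" by (rule cring_poly_alg)
  have inv: "\<ominus>\<^bsub>poly_alg r\<^esub> f = - f" if "f \<in> polys r" for f :: "'k mpol"
    using that by (intro R.minus_equality) simp_all
  interpret ins: comm_ring_hom "insertion \<phi> x" by (rule insertion_comm_ring_hom)
  show ?thesis
  proof (rule primeidealI)
    show "ideal {f \<in> polys r. insertion \<phi> x f = 0} (poly_alg r)"
    proof (rule idealI[OF R.ring_axioms])
      show "subgroup {f \<in> polys r. insertion \<phi> x f = 0} (add_monoid (poly_alg r))"
        by (rule R.add.subgroupI)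
          (auto simp: inv ins.hom_add ins.hom_uminus a_inv_def[symmetric] intro: exI[of _ 0])
    qed (simp_all add: ins.hom_mult)
    have "(1 :: 'k mpol) \<in> polys r" "insertion \<phi> x 1 \<noteq> 0" by simp_all
    then show "carrier (poly_alg r) \<noteq> {f \<in> polys r. insertion \<phi> x f = 0}"
      unfolding poly_alg_simps by blast
  qed (auto simp: R.is_cring ins.hom_mult)
qed

lemma vectorspace_polys_hom:
  "vectorspace class_ring ((poly_alg r)\<lparr>carrier := polys_hom r d\<rparr> :: ('k::field, 'k mpol) module)"
proof (rule vs_criteria[OF class_field])
  have "f + Poly_Mapping.single 0 (- 1) * f = 0" for f :: "'k mpol"
    by (simp add: single_uminus)
  then show "\<forall>f\<in>carrier ((poly_alg r)\<lparr>carrier := polys_hom r d\<rparr>).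
      \<exists>g\<in>carrier ((poly_alg r)\<lparr>carrier := polys_hom r d\<rparr>). f \<oplus>\<^bsub>(poly_alg r)\<lparr>carrier := polys_hom r d\<rparr>\<^esub> g =
        \<zero>\<^bsub>(poly_alg r :: ('k, 'k mpol) module)\<lparr>carrier := polys_hom r d\<rparr>\<^esub>"
    using polys_hom_smult by (fastforce simp: poly_alg_def)
qed (auto simp: poly_alg_def add_ac ring_distribs single_add mult_single mult.assoc[symmetric])

lemma peval_smult_polys_hom:
  assumes "f \<in> polys_hom r d" "x \<in> carrier_vec r"
  shows "peval f (c \<cdot>\<^sub>v x) = c ^ d * peval f x"
proof -
  have "peval f (c \<cdot>\<^sub>v x) = insertion id (\<lambda>i. c * x $ i) f"
    unfolding peval_eq_insertion
    using assms polys_hom_subset[of r d] by (intro insertion_cong[of f r]) auto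
  then show ?thesis
    using assms(1) by (simp add: peval_eq_insertion id_hom.insertion_polys_hom_scale)
qed

text \<open>The representatives are the nonzero multiples of (x,1), and a form of degree d changes
  by the factor c^d under scaling by c.\<close>

lemma polys_hom_vanish_proj_image:
  assumes f: "f \<in> polys_hom (s + 1) d" and X: "X \<subseteq> carrier_vec s"
  shows "(\<forall>p\<in>proj_image X. \<forall>x\<in>p. peval f x = 0) \<longleftrightarrow> (\<forall>x\<in>X. peval f (append_one x) = 0)"
proof
  assume "\<forall>p\<in>proj_image X. \<forall>x\<in>p. peval f x = 0"
  then show "\<forall>x\<in>X. peval f (append_one x) = 0"
    unfolding proj_image_def proj_point_def
    by (metis (mono_tags, lifting) image_eqI mem_Collect_eq one_smult_vec zero_neq_one)
next
  assume *: "\<forall>x\<in>X. peval f (append_one x) = 0"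
  have "peval f (c \<cdot>\<^sub>v append_one x) = 0" if "x \<in> X" for c x
    using peval_smult_polys_hom[OF f append_one_carrier, of x c] X * that by auto
  then show "\<forall>p\<in>proj_image X. \<forall>x\<in>p. peval f x = 0"
    by (auto simp: proj_image_def proj_point_def)
qed

text \<open>The generators of I(Y), tested at one representative per point.\<close>

definition vanishing_forms :: "nat \<Rightarrow> 'k::field vec set \<Rightarrow> 'k mpol set" where
  "vanishing_forms s X = {f. (\<exists>d. f \<in> polys_hom (s + 1) d) \<and> (\<forall>x\<in>X. peval f (append_one x) = 0)}"

lemma vanishing_ideal_proj_image:
  assumes "X \<subseteq> carrier_vec s"
  shows "vanishing_ideal s (proj_image X) = genideal (poly_alg (s + 1)) (vanishing_forms s X)"
  unfolding vanishing_ideal_def vanishing_forms_def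
  using polys_hom_vanish_proj_image[OF _ assms] by (metis (no_types, lifting))

lemma vanishing_forms_subset: "vanishing_forms s X \<subseteq> polys (s + 1)"
  using polys_hom_subset by (auto simp: vanishing_forms_def)

lemma ideal_vanishing_ideal:
  assumes "X \<subseteq> carrier_vec s"
  shows "ideal (vanishing_ideal s (proj_image X)) (poly_alg (s + 1))"
    and "vanishing_forms s X \<subseteq> vanishing_ideal s (proj_image X)"
  unfolding vanishing_ideal_proj_image[OF assms]
  using ring.genideal_ideal[OF cring.axioms(1)[OF cring_poly_alg], of "vanishing_forms s X" "s + 1"]
    ring.genideal_self[OF cring.axioms(1)[OF cring_poly_alg], of "vanishing_forms s X" "s + 1"]
    vanishing_forms_subset[of s X]
  by simp_all

lemma vanishing_ideal_minimal:
  assumes "X \<subseteq> carrier_vec s" "ideal J (poly_alg (s + 1))" "vanishing_forms s X \<subseteq> J"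
  shows "vanishing_ideal s (proj_image X) \<subseteq> J"
  unfolding vanishing_ideal_proj_image[OF assms(1)]
  by (rule ring.genideal_minimal[OF cring.axioms(1)[OF cring_poly_alg] assms(2,3)])

text \<open>The kernel is the homogeneous ideal of the point [(x,1)]: the substitution restricts
  polynomials to the line through the origin and (x,1), and a form f of degree d becomes f(x,1)
  u^d.\<close>

lemma vanishing_ideal_subset_point_ideal:
  assumes X: "X \<subseteq> carrier_vec s" and x: "x \<in> X"
  shows "vanishing_ideal s (proj_image X) \<subseteq>
    {f \<in> polys (s + 1). insertion (\<lambda>c. [:c:]) (\<lambda>i. [:0, append_one x $ i:]) f = 0}"
proof (rule vanishing_ideal_minimal[OF X])
  show "ideal {f \<in> polys (s + 1). insertion (\<lambda>c. [:c:]) (\<lambda>i. [:0, append_one x $ i:]) f = 0}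
      (poly_alg (s + 1))"
    by (intro primeideal.axioms(1) primeideal_insertion_kernel poly_const.comm_ring_hom_axioms)
  have "insertion (\<lambda>c. [:c:]) (\<lambda>i. [:0, append_one x $ i:]) f = [:0, 1:] ^ d * [:peval f (append_one x):]"
    if "f \<in> polys_hom (s + 1) d" for f d
  proof -
    have "insertion (\<lambda>c. [:c:]) (\<lambda>i. [:0, append_one x $ i:]) f =
        insertion (\<lambda>c. [:c:]) (\<lambda>i. [:0, 1:] * [:append_one x $ i:]) f"
      by simp
    also have "\<dots> = [:0, 1:] ^ d * insertion (\<lambda>c. [:c:]) (\<lambda>i. [:append_one x $ i:]) f"
      by (rule poly_const.insertion_polys_hom_scale[OF that])
    finally show ?thesis
      using id_hom.insertion_comp[OF poly_const.comm_ring_hom_axioms, of "\<lambda>i. append_one x $ i" f]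
      by (simp add: peval_eq_insertion comp_def)
  qed
  then show "vanishing_forms s X \<subseteq>
      {f \<in> polys (s + 1). insertion (\<lambda>c. [:c:]) (\<lambda>i. [:0, append_one x $ i:]) f = 0}"
    using x polys_hom_subset by (fastforce simp: vanishing_forms_def)
qed

text \<open>A form in the ideal generated by vanishing forms must itself vanish: the polynomials
  vanishing at (x,1) are an ideal containing all generators.\<close>

lemma vanishing_ideal_Int_polys_hom:
  assumes X: "X \<subseteq> carrier_vec s"
  shows "vanishing_ideal s (proj_image X) \<inter> polys_hom (s + 1) d =
    {f \<in> polys_hom (s + 1) d. \<forall>x\<in>X. peval f (append_one x) = 0}"
proof
  show "{f \<in> polys_hom (s + 1) d. \<forall>x\<in>X. peval f (append_one x) = 0} \<subseteq>
      vanishing_ideal s (proj_image X) \<inter> polys_hom (s + 1) d"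
    using ideal_vanishing_ideal(2)[OF X] by (auto simp: vanishing_forms_def)
  have "vanishing_ideal s (proj_image X) \<subseteq>
      {f \<in> polys (s + 1). insertion id (\<lambda>i. append_one x $ i) f = 0}" if "x \<in> X" for x
    using that vanishing_forms_subset[of s X]
    by (intro vanishing_ideal_minimal[OF X] primeideal.axioms(1) primeideal_insertion_kernel
        id_hom.comm_ring_hom_axioms)
      (auto simp: vanishing_forms_def peval_eq_insertion)
  then show "vanishing_ideal s (proj_image X) \<inter> polys_hom (s + 1) d \<subseteq>
      {f \<in> polys_hom (s + 1) d. \<forall>x\<in>X. peval f (append_one x) = 0}"
    by (auto simp: peval_eq_insertion)
qed

section \<open>Krull dimension of the coordinate ring\<close>

lemma zero_FactRing: "\<zero>\<^bsub>R Quot I\<^esub> = I"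
  by (simp add: FactRing_def)

lemma carrier_FactRing: "carrier (R Quot I) = (\<lambda>a. I +>\<^bsub>R\<^esub> a) ` carrier R"
  by (auto simp: FactRing_def A_RCOSETS_def')

text \<open>Since I lies in J, the set J is a union of cosets of I.\<close>

lemma (in cring) quot_image_mem_iff:
  assumes "ideal I R" "ideal J R" "I \<subseteq> J" "a \<in> carrier R"
  shows "I +> a \<in> (+>) I ` J \<longleftrightarrow> a \<in> J"
proof -
  have "\<Union> ((+>) I ` J) = J" using ideal_incl_iff[OF assms(1,2)] assms(3) by simp
  moreover have "(+>) I ` J \<subseteq> carrier (R Quot I)"
    using ideal.Icarr[OF assms(2)] by (auto simp: carrier_FactRing)
  ultimately show ?thesis
    using canonical_proj_vimage_mem_iff[OF assms(1) _ assms(4)] by metis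
qed

lemma (in cring) primeideal_quot_image:
  assumes I: "ideal I R" and J: "primeideal J R" and "I \<subseteq> J"
  shows "primeideal ((+>) I ` J) (R Quot I)"
proof (rule primeidealI)
  interpret J: primeideal J R by fact
  note mem = quot_image_mem_iff[OF I J.is_ideal \<open>I \<subseteq> J\<close>]
  show "ideal ((+>) I ` J) (R Quot I)"
    by (rule ring_ideal_imp_quot_ideal[OF I J.is_ideal])
  show "cring (R Quot I)"
    by (rule ideal.quotient_is_cring[OF I is_cring])
  obtain a where "a \<in> carrier R" "a \<notin> J" using J.I_notcarr J.Icarr by blast
  then show "carrier (R Quot I) \<noteq> (+>) I ` J"
    using mem[of a] by (auto simp: carrier_FactRing)
  fix A B assume "A \<in> carrier (R Quot I)" "B \<in> carrier (R Quot I)"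
    and AB: "A \<otimes>\<^bsub>R Quot I\<^esub> B \<in> (+>) I ` J"
  then obtain a b where ab: "a \<in> carrier R" "b \<in> carrier R" "A = I +> a" "B = I +> b"
    by (auto simp: carrier_FactRing)
  then have "I +> (a \<otimes> b) \<in> (+>) I ` J"
    using AB ideal.rcoset_mult_add[OF I, of a b] by (simp add: FactRing_def)
  then show "A \<in> (+>) I ` J \<or> B \<in> (+>) I ` J"
    using ab mem J.I_prime by auto
qed

text \<open>Moves the Krull dimension of the quotient to chains in R: primes are pulled back along
  the projection, or pushed forward when they contain I. Strictness survives by surjectivity in the
  first case and by \<open>quot_image_mem_iff\<close> in the second.\<close>

lemma (in cring) prime_chain_quot_iff:
  assumes I: "ideal I R"
  shows "(\<exists>p :: nat \<Rightarrow> 'a set set. (\<forall>i\<le>l. primeideal (p i) (R Quot I)) \<and> (\<forall>i<l. p i \<subset> p (Suc i))) \<longleftrightarrow>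
    (\<exists>p :: nat \<Rightarrow> 'a set. (\<forall>i\<le>l. primeideal (p i) R \<and> I \<subseteq> p i) \<and> (\<forall>i<l. p i \<subset> p (Suc i)))"
    (is "?L \<longleftrightarrow> ?R")
proof
  interpret \<pi>: ring_hom_ring R "R Quot I" "(+>) I" by (rule ideal.rcos_ring_hom_ring[OF I])
  assume ?L
  then obtain p where p: "\<And>i. i \<le> l \<Longrightarrow> primeideal (p i) (R Quot I)" "\<And>i. i < l \<Longrightarrow> p i \<subset> p (Suc i)"
    by blast
  define q where "q i = {a \<in> carrier R. I +> a \<in> p i}" for i
  have "primeideal (q i) R" if "i \<le> l" for i
    unfolding q_def by (rule \<pi>.primeideal_vimage[OF is_cring p(1)[OF that]])
  moreover have "I \<subseteq> q i" if "i \<le> l" for i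
  proof
    fix a assume a: "a \<in> I"
    have "I +> a = I"
      by (rule abelian_subgroup.a_rcos_const[OF abelian_subgroupI3[OF ideal.axioms(1)[OF I] abelian_group_axioms] a])
    \<comment> \<open>The coset I is the zero of the quotient, hence in every ideal of it.\<close>
    moreover have "\<zero>\<^bsub>R Quot I\<^esub> \<in> p i"
      by (rule additive_subgroup.zero_closed[OF ideal.axioms(1)[OF primeideal.axioms(1)[OF p(1)[OF that]]]])
    then have "I \<in> p i" unfolding zero_FactRing .
    ultimately show "a \<in> q i" using ideal.Icarr[OF I a] by (simp add: q_def)
  qed
  moreover have "q i \<subset> q (Suc i)" if i: "i < l" for i
  proof -
    obtain A where A: "A \<in> p (Suc i)" "A \<notin> p i" using p(2)[OF i] by blast
    have "primeideal (p (Suc i)) (R Quot I)" using p(1) i by simp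
    from ideal.Icarr[OF primeideal.axioms(1)[OF this] A(1)]
    obtain a where "a \<in> carrier R" "A = I +> a"
      by (auto simp: carrier_FactRing)
    then show ?thesis using A p(2)[OF i] by (auto simp: q_def)
  qed
  ultimately show ?R by blast
next
  assume ?R
  then obtain p where p: "\<And>i. i \<le> l \<Longrightarrow> primeideal (p i) R" "\<And>i. i \<le> l \<Longrightarrow> I \<subseteq> p i"
      "\<And>i. i < l \<Longrightarrow> p i \<subset> p (Suc i)"
    by blast
  have "(+>) I ` p i \<subset> (+>) I ` p (Suc i)" if i: "i < l" for i
  proof -
    have prime: "primeideal (p i) R" "primeideal (p (Suc i)) R" using p(1) i by auto
    obtain a where a: "a \<in> p (Suc i)" "a \<notin> p i" using p(3)[OF i] by blast
    then have "a \<in> carrier R"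
      using prime(2) by (meson ideal.Icarr primeideal.axioms(1))
    then have "I +> a \<notin> (+>) I ` p i"
      using quot_image_mem_iff[OF I primeideal.axioms(1)[OF prime(1)] p(2)] a i by simp
    then show ?thesis using a p(3)[OF i] by blast
  qed
  moreover have "primeideal ((+>) I ` p i) (R Quot I)" if "i \<le> l" for i
    using primeideal_quot_image[OF I p(1,2)] that by simp
  ultimately show ?L by (intro exI[of _ "\<lambda>i. (+>) I ` p i"]) simp
qed

text \<open>Excluding length two suffices, as a longer chain contains its first three
  primes.\<close>

lemma krull_dim_eq_oneI:
  assumes one: "\<exists>p. (\<forall>i\<le>1. primeideal (p i) R) \<and> (\<forall>i<1. p i \<subset> p (Suc i))"
    and two: "\<nexists>p. (\<forall>i\<le>2. primeideal (p i) R) \<and> (\<forall>i<2. p i \<subset> p (Suc i))"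
  shows "krull_dim R = 1"
proof -
  let ?chain = "\<lambda>l. \<exists>p. (\<forall>i\<le>l. primeideal (p i) R) \<and> (\<forall>i<l. p i \<subset> p (Suc i))"
  have le_one: "l \<le> 1" if chain: "?chain l" for l
  proof (rule ccontr)
    assume "\<not> l \<le> 1"
    moreover obtain p where "\<forall>i\<le>l. primeideal (p i) R" "\<forall>i<l. p i \<subset> p (Suc i)"
      using chain by blast
    ultimately have "(\<forall>i\<le>2. primeideal (p i) R) \<and> (\<forall>i<2. p i \<subset> p (Suc i))" by simp
    with two show False by blast
  qed
  have "e \<le> 1" if "e \<in> {enat l | l. ?chain l}" for e
  proof -
    from that obtain l where "e = enat l" "?chain l" by blast
    then show ?thesis using le_one[of l] by (simp add: one_enat_def)
  qed
  moreover have "1 \<in> {enat l | l. ?chain l}" using one by (auto simp: one_enat_def)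
  ultimately show ?thesis
    unfolding krull_dim_def by (intro cSup_eq_maximum)
qed

text \<open>Let h generate J and p generate M, so that h = p b. Primality puts p or b into J; the
  first gives M = J, the second makes p a unit of K[u].\<close>

lemma field_poly_prime_ideal_maximal:
  fixes J M :: "'k::field poly set"
  assumes J: "\<And>a b. a \<in> J \<Longrightarrow> b \<in> J \<Longrightarrow> a - b \<in> J" "\<And>a b. b \<in> J \<Longrightarrow> a * b \<in> J"
      "\<And>a b. a * b \<in> J \<Longrightarrow> a \<in> J \<or> b \<in> J"
    and M: "\<And>a b. a \<in> M \<Longrightarrow> b \<in> M \<Longrightarrow> a - b \<in> M" "\<And>a b. b \<in> M \<Longrightarrow> a * b \<in> M" "1 \<notin> M"
    and "J \<subseteq> M" "g \<in> J" "g \<noteq> 0"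
  shows "J = M"
proof -
  \<comment> \<open>An element of least degree among the nonzero ones generates, by division with
    remainder; g shows that there is one.\<close>
  have minimal: "\<exists>p\<in>N. p \<noteq> 0 \<and> (\<forall>q\<in>N. p dvd q)"
    if N: "g \<in> N" "\<And>a b. a \<in> N \<Longrightarrow> b \<in> N \<Longrightarrow> a - b \<in> N" "\<And>a b. b \<in> N \<Longrightarrow> a * b \<in> N" for N
  proof -
    obtain p where p: "p \<in> N \<and> p \<noteq> 0" "\<And>q. q \<in> N \<and> q \<noteq> 0 \<Longrightarrow> degree p \<le> degree q"
      using exists_least_iff[of "\<lambda>k. \<exists>p. p \<in> N \<and> p \<noteq> 0 \<and> degree p = k"] N(1) \<open>g \<noteq> 0\<close>
      by (metis not_less)
    have "p dvd q" if "q \<in> N" for q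
    proof (rule ccontr)
      assume "\<not> p dvd q"
      then have "q mod p \<noteq> 0" by (simp add: dvd_eq_mod_eq_0)
      moreover have "q mod p \<in> N"
        using N(2)[OF that N(3)[of p "q div p"]] p(1) by (simp add: minus_div_mult_eq_mod)
      ultimately show False
        using p degree_mod_less[of p q] by (meson leD)
    qed
    with p(1) show ?thesis by blast
  qed
  obtain p where p: "p \<in> M" "p \<noteq> 0" "\<And>q. q \<in> M \<Longrightarrow> p dvd q"
    using minimal[OF subsetD[OF \<open>J \<subseteq> M\<close> \<open>g \<in> J\<close>] M(1,2)] by blast
  obtain h where h: "h \<in> J" "h \<noteq> 0" "\<And>q. q \<in> J \<Longrightarrow> h dvd q"
    using minimal[OF \<open>g \<in> J\<close> J(1,2)] by blast
  obtain b where b: "h = p * b" using p(3)[of h] h(1) \<open>J \<subseteq> M\<close> unfolding dvd_def by blast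
  have "b \<notin> J"
  proof
    assume "b \<in> J"
    then have "p * b dvd b" using h(3) b by simp
    then have "p dvd 1" using h(2) b by (simp add: dvd_mult_cancel_right)
    then obtain c where "1 = p * c" by (rule dvdE)
    then show False using M(2)[OF p(1), of c] M(3) by (simp add: mult.commute)
  qed
  then have "p \<in> J" using J(3)[of p b] h(1) b by simp
  have "M \<subseteq> J"
  proof
    fix q assume "q \<in> M"
    then have "p dvd q" by (rule p(3))
    then obtain c where "q = p * c" by (rule dvdE)
    then show "q \<in> J" using J(2)[OF \<open>p \<in> J\<close>, of c] by (simp add: mult.commute)
  qed
  with \<open>J \<subseteq> M\<close> show ?thesis by blast
qed

section \<open>Evaluation codes on a finite set of points\<close>

text \<open>What the argument keeps of a toric set. The nonzero first coordinates are what allows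
  division by f_0 = t_1^d.\<close>

locale affine_points =
  fixes s m :: nat and P :: "nat \<Rightarrow> 'k::field vec"
  assumes s_pos: "s \<ge> 1" and m_pos: "m \<ge> 1"
    and P_carrier: "\<And>i. i < m \<Longrightarrow> P i \<in> carrier_vec s"
    and P_nonzero: "\<And>i. i < m \<Longrightarrow> P i $ 0 \<noteq> 0"
    and P_inj: "inj_on P {..<m}"
begin

abbreviation "X \<equiv> P ` {..<m}"
abbreviation "I \<equiv> vanishing_ideal s (proj_image X)"
abbreviation "R \<equiv> poly_alg (s + 1) :: ('k, 'k mpol) module"
abbreviation "Q i \<equiv> append_one (P i)"
abbreviation "C d \<equiv> affine_code s d m P"
abbreviation "D d \<equiv> projective_code s d m Q"

lemma X_carrier: "X \<subseteq> carrier_vec s"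
  using P_carrier by auto

lemma affine_word_add: "affine_word m P (f + g) = affine_word m P f + affine_word m P g"
  by (rule eq_vecI) (simp_all add: affine_word_def peval.hom_add)

lemma affine_word_smult:
  "affine_word m P (Poly_Mapping.single 0 c * f) = c \<cdot>\<^sub>v affine_word m P f"
  by (rule eq_vecI) (simp_all add: affine_word_def peval.hom_mult)

lemma affine_code_carrier: "C d \<subseteq> carrier_vec m"
  by (auto simp: affine_code_def affine_word_def)

lemma zero_affine_code: "0\<^sub>v m \<in> C d"
proof -
  have "affine_word m P 0 = 0\<^sub>v m" by (rule eq_vecI) (simp_all add: affine_word_def)
  then show ?thesis unfolding affine_code_def by (metis imageI polys_le_zero)
qed

lemma affine_code_add: "x \<in> C d \<Longrightarrow> y \<in> C d \<Longrightarrow> x + y \<in> C d"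
  unfolding affine_code_def by (auto simp flip: affine_word_add)

lemma affine_code_smult: "x \<in> C d \<Longrightarrow> c \<cdot>\<^sub>v x \<in> C d"
  unfolding affine_code_def by (auto simp flip: affine_word_smult)

lemma code_length_affine_code: "code_length (C d) = m"
  using zero_affine_code by (intro code_length_eq affine_code_carrier) auto

lemma vectorspace_affine_code: "vectorspace class_ring (code_space (C d))"
  using affine_code_carrier zero_affine_code affine_code_add affine_code_smult
  by (rule vectorspace_code_space)

section \<open>The isomorphism between the affine and the projective code\<close>

lemma f0_nonzero: "i < m \<Longrightarrow> peval (tvar 0 ^ d) (P i) \<noteq> 0"
  using P_nonzero by (simp add: peval.hom_power)

lemma peval_f0_append_one: "i < m \<Longrightarrow> peval (tvar 0 ^ d) (Q i) = peval (tvar 0 ^ d) (P i)"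
  using index_append_one(1)[OF P_carrier, of i 0] s_pos by (simp add: peval.hom_power)

text \<open>The map of part (a). Since it acts on words and not on polynomials, it is well defined
  whatever f represents the word.\<close>

definition rescale :: "nat \<Rightarrow> 'k vec \<Rightarrow> 'k vec" where
  "rescale d w = vec m (\<lambda>i. w $ i / peval (tvar 0 ^ d) (P i))"

lemma rescale_affine_word:
  assumes "f \<in> polys_le s d"
  shows "rescale d (affine_word m P f) = projective_word m Q (tvar 0 ^ d) (homogenize s d f)"
    and "projective_word m Q (tvar 0 ^ d) (homogenize s d f) =
      vec m (\<lambda>i. peval f (P i) / peval (tvar 0 ^ d) (P i))"
  using assms P_carrier by (auto simp: rescale_def affine_word_def projective_word_def
      peval_f0_append_one peval_homogenize intro!: eq_vecI)

text \<open>Homogenizing gives one inclusion, setting u = 1 the other.\<close>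

lemma rescale_image: "rescale d ` C d = D d"
proof
  show "rescale d ` C d \<subseteq> D d"
    unfolding affine_code_def projective_code_def
    by (auto intro!: imageI simp: rescale_affine_word(1) homogenize_in_polys_hom[simplified])
  show "D d \<subseteq> rescale d ` C d"
  proof
    fix w assume "w \<in> D d"
    then obtain g where g: "g \<in> polys_hom (s + 1) d" "w = projective_word m Q (tvar 0 ^ d) g"
      unfolding projective_code_def by auto
    then have "w = rescale d (affine_word m P (dehomogenize s g))"
      using P_carrier by (auto simp: rescale_def affine_word_def projective_word_def
          peval_f0_append_one peval_dehomogenize intro!: eq_vecI)
    then show "w \<in> rescale d ` C d"
      using dehomogenize_in_polys_le[OF g(1)] by (auto simp: affine_code_def)
  qed
qed

lemma rescale_inj: "inj_on (rescale d) (carrier_vec m)"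
proof (rule inj_onI, rule eq_vecI)
  fix x y :: "'k vec" and i
  assume xy: "x \<in> carrier_vec m" "y \<in> carrier_vec m" "rescale d x = rescale d y" and "i < dim_vec y"
  then have i: "i < m" by simp
  have "rescale d x $ i = rescale d y $ i" using xy by simp
  then show "x $ i = y $ i" using i f0_nonzero by (simp add: rescale_def)
qed auto

lemma rescale_bij_betw: "bij_betw (rescale d) (C d) (D d)"
  unfolding bij_betw_def using rescale_image inj_on_subset[OF rescale_inj affine_code_carrier] by blast

lemma rescale_add:
  "x \<in> carrier_vec m \<Longrightarrow> y \<in> carrier_vec m \<Longrightarrow> rescale d (x + y) = rescale d x + rescale d y"
  by (rule eq_vecI) (simp_all add: rescale_def add_divide_distrib)

lemma rescale_smult: "x \<in> carrier_vec m \<Longrightarrow> rescale d (c \<cdot>\<^sub>v x) = c \<cdot>\<^sub>v rescale d x"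
  by (rule eq_vecI) (simp_all add: rescale_def)

lemma rescale_zero: "rescale d (0\<^sub>v m) = 0\<^sub>v m"
  by (rule eq_vecI) (simp_all add: rescale_def)

lemma projective_code_carrier: "D d \<subseteq> carrier_vec m"
  by (auto simp: projective_code_def projective_word_def)

lemma zero_projective_code: "0\<^sub>v m \<in> D d"
  using zero_affine_code[of d] rescale_zero[of d] unfolding rescale_image[symmetric] by (metis imageI)

lemma code_length_projective_code: "code_length (D d) = m"
  using zero_projective_code by (intro code_length_eq projective_code_carrier) auto

lemma projective_word_add:
  "projective_word m Q h (f + g) = projective_word m Q h f + projective_word m Q h g"
  by (rule eq_vecI) (simp_all add: projective_word_def peval.hom_add add_divide_distrib)

lemma projective_word_smult:
  "projective_word m Q h (Poly_Mapping.single 0 c * f) = c \<cdot>\<^sub>v projective_word m Q h f"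
  by (rule eq_vecI) (simp_all add: projective_word_def peval.hom_mult)

lemma vectorspace_projective_code: "vectorspace class_ring (code_space (D d))"
  using projective_code_carrier zero_projective_code
proof (rule vectorspace_code_space)
  show "x + y \<in> D d" if "x \<in> D d" "y \<in> D d" for x y
    using that unfolding projective_code_def by (auto simp flip: projective_word_add)
  show "c \<cdot>\<^sub>v x \<in> D d" if "x \<in> D d" for c x
    using that unfolding projective_code_def by (auto simp flip: projective_word_smult)
qed

lemma rescale_linear_map: "linear_map class_ring (code_space (C d)) (code_space (D d)) (rescale d)"
  using vectorspace_affine_code[of d] vectorspace_projective_code[of d] affine_code_carrier[of d]
    rescale_image[of d] rescale_add rescale_smult
  by (auto simp: linear_map_def mod_hom_def mod_hom_axioms_def module_hom_def vectorspace_def subset_iff)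

lemma hamming_weight_rescale: "hamming_weight (rescale d x) = hamming_weight x" if "x \<in> carrier_vec m"
proof -
  have "{i. i < dim_vec (rescale d x) \<and> rescale d x $ i \<noteq> 0} = {i. i < dim_vec x \<and> x $ i \<noteq> 0}"
    using that f0_nonzero by (auto simp: rescale_def)
  then show ?thesis by (simp add: hamming_weight_def)
qed

text \<open>The map keeps supports and fixes the zero word, so both minima range over the same set
  of weights.\<close>

lemma min_distance_eq: "min_distance (C d) = min_distance (D d)"
proof -
  have "D d - {0\<^sub>v m} = rescale d ` (C d - {0\<^sub>v m})"
    using inj_on_image_set_diff[OF rescale_inj[of d], of "C d" "{0\<^sub>v m}"] affine_code_carrier[of d]
    by (simp add: rescale_image rescale_zero subset_insertI2 Diff_subset[THEN subset_trans])
  moreover have "hamming_weight ` rescale d ` (C d - {0\<^sub>v m}) = hamming_weight ` (C d - {0\<^sub>v m})"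
    unfolding image_image using affine_code_carrier
    by (intro image_cong refl hamming_weight_rescale) auto
  ultimately show ?thesis
    by (simp add: min_distance_def code_length_affine_code code_length_projective_code)
qed

text \<open>Lagrange interpolation with products of affine linear forms.\<close>

lemma affine_code_eq_carrier_vec:
  assumes "d \<ge> m"
  shows "C d = carrier_vec m"
proof
  show "carrier_vec m \<subseteq> C d"
  proof
    fix w :: "'k vec" assume w: "w \<in> carrier_vec m"
    have "\<exists>i<s. P j $ i \<noteq> P k $ i" if "j < m" "k < m" "j \<noteq> k" for j k
    proof (rule ccontr)
      assume "\<not> ?thesis"
      moreover have "dim_vec (P j) = s" "dim_vec (P k) = s" using P_carrier that by auto
      ultimately have "P j = P k" by (intro eq_vecI) auto
      then show False using P_inj that by (auto dest: inj_onD)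
    qed
    then obtain c where c: "\<And>j k. j < m \<Longrightarrow> k < m \<Longrightarrow> j \<noteq> k \<Longrightarrow> c j k < s \<and> P j $ c j k \<noteq> P k $ c j k"
      by metis
    \<comment> \<open>A product of m - 1 affine linear forms, vanishing at every point but P_k: the
      factor for j uses a coordinate in which P_j and P_k differ.\<close>
    define L where "L k = (\<Prod>j\<in>{..<m} - {k}. tvar (c j k) + Poly_Mapping.single 0 (- (P j $ c j k)))" for k
    have L: "L k \<in> polys_le s d" if "k < m" for k
    proof -
      have "L k \<in> polys_le s (card ({..<m} - {k}))"
        unfolding L_def using c that by (intro polys_le_prod polys_le_add polys_le_tvar) auto
      then show ?thesis
        by (rule polys_le_mono) (use card_mono[of "{..<m}" "{..<m} - {k}"] assms in simp)
    qed
    have peval_L: "peval (L k) x = (\<Prod>j\<in>{..<m} - {k}. x $ c j k - P j $ c j k)" for k x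
      by (simp add: L_def peval.hom_prod peval.hom_add)
    have nz: "peval (L k) (P k) \<noteq> 0" if "k < m" for k
      unfolding peval_L using c[OF _ that] by fastforce
    have z: "peval (L k) (P l) = 0" if "k < m" "l < m" "l \<noteq> k" for k l
      unfolding peval_L using that by (intro prod_zero) auto
    define f where "f = (\<Sum>k<m. Poly_Mapping.single 0 (w $ k / peval (L k) (P k)) * L k)"
    have "f \<in> polys_le s d"
      unfolding f_def using L by (intro polys_le_sum polys_le_smult) auto
    moreover have "peval f (P l) = w $ l" if "l < m" for l
    proof -
      have "peval f (P l) = (\<Sum>k<m. if k = l then w $ l else 0)"
        unfolding f_def peval.hom_sum
        using nz z that by (intro sum.cong) (auto simp: peval.hom_mult)
      then show ?thesis using that by simp
    qed
    then have "affine_word m P f = w" using w by (auto simp: affine_word_def)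
    ultimately show "w \<in> C d" unfolding affine_code_def by blast
  qed
qed (rule affine_code_carrier)

section \<open>Primes above the vanishing ideal\<close>

lemma prime_contains_point_forms:
  assumes q: "primeideal q R" and "I \<subseteq> q"
  shows "\<exists>k<m. \<forall>i<s. tvar i - Poly_Mapping.single 0 (P k $ i) * tvar s \<in> q"
proof (rule ccontr)
  note q = primeideal_poly_alg[OF q]
  let ?l = "\<lambda>k i. tvar i - Poly_Mapping.single 0 (P k $ i) * tvar s"
  assume "\<not> ?thesis"
  then obtain c where c: "\<And>k. k < m \<Longrightarrow> c k < s \<and> ?l k (c k) \<notin> q" by metis
  have "(\<Prod>k<m. ?l k (c k)) \<in> polys_hom (s + 1) (card {..<m})"
    using c by (intro polys_hom_prod polys_hom_diff polys_hom_smult polys_hom_tvar) (auto simp: less_SucI)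
  \<comment> \<open>The factor chosen for the j-th point vanishes at (P_j,1).\<close>
  moreover have "peval (\<Prod>k<m. ?l k (c k)) (Q j) = 0" if "j < m" for j
    unfolding peval.hom_prod
  proof (rule prod_zero)
    show "\<exists>k\<in>{..<m}. peval (?l k (c k)) (Q j) = 0"
      using that c[of j] index_append_one[OF P_carrier[OF that]]
      by (intro bexI[of _ j]) (auto simp: peval.hom_minus peval.hom_mult)
  qed simp
  ultimately have "(\<Prod>k<m. ?l k (c k)) \<in> vanishing_forms s X"
    by (auto simp: vanishing_forms_def)
  then have "(\<Prod>k<m. ?l k (c k)) \<in> q"
    using ideal_vanishing_ideal(2)[OF X_carrier] \<open>I \<subseteq> q\<close> by blast
  \<comment> \<open>Primality handles two factors at a time; the empty product 1 is outside
    q.\<close>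
  moreover have "(\<Prod>k\<in>A. ?l k (c k)) \<notin> q" if "A \<subseteq> {..<m}" for A
    using finite_subset[OF that finite_lessThan] that
  proof (induction A rule: finite_induct)
    case empty
    then show ?case using q(5) by simp
  next
    case (insert k A)
    have "?l k (c k) \<in> polys (s + 1)" if "k < m" for k
      using c[OF that] by (intro polys_diff polys_mult polys_tvar polys_const) auto
    moreover from this have "(\<Prod>k\<in>A. ?l k (c k)) \<in> polys (s + 1)"
      using insert.prems by (intro polys_prod) auto
    ultimately show ?case
      using insert c[of k] q(6)[of "?l k (c k)" "\<Prod>k\<in>A. ?l k (c k)"] by auto
  qed
  ultimately show False by blast
qed

text \<open>Modulo the linear forms of a point every polynomial is congruent to a polynomial in \<open>u\<close>, so
  a chain of primes above \<open>I\<close> restricts to a chain of primes of \<open>K[u]\<close>.\<close>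

lemma no_prime_chain_of_length_two:
  "\<nexists>p. (\<forall>i\<le>2. primeideal (p i) R \<and> I \<subseteq> p i) \<and> (\<forall>i<2. p i \<subset> p (Suc i))"
proof
  assume "\<exists>p. (\<forall>i\<le>2. primeideal (p i) R \<and> I \<subseteq> p i) \<and> (\<forall>i<2. p i \<subset> p (Suc i))"
  then obtain p where p: "\<forall>i\<le>2. primeideal (p i) R \<and> I \<subseteq> p i" "\<forall>i<2. p i \<subset> p (Suc i)"
    by blast
  define q0 q1 q2 where q_def: "q0 = p 0" "q1 = p 1" "q2 = p 2"
  have prime: "primeideal q0 R" "primeideal q1 R" "primeideal q2 R" and "I \<subseteq> q0"
    using p(1) by (auto simp: q_def)
  have chain: "q0 \<subset> q1" "q1 \<subset> q2"
    using p(2)[rule_format, of 0] p(2)[rule_format, of 1] by (auto simp: q_def numeral_2_eq_2)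
  note q0 = primeideal_poly_alg[OF prime(1)]
  obtain k where k: "k < m" "\<And>i. i < s \<Longrightarrow> tvar i - Poly_Mapping.single 0 (P k $ i) * tvar s \<in> q0"
    using prime_contains_point_forms[OF prime(1) \<open>I \<subseteq> q0\<close>] by blast
  \<comment> \<open>The embedding of K[u] into S[u].\<close>
  define \<eta> :: "'k poly \<Rightarrow> 'k mpol" where "\<eta> g = poly (map_poly (Poly_Mapping.single 0) g) (tvar s)" for g
  interpret map: map_poly_comm_ring_hom "Poly_Mapping.single 0 :: 'k \<Rightarrow> 'k mpol" ..
  interpret \<eta>: comm_ring_hom \<eta>
    by unfold_locales (simp_all add: \<eta>_def map.hom_add map.hom_mult)
  \<comment> \<open>Restriction to the line through (P_k,1), with u as parameter.\<close>
  define g where "g f = insertion (\<lambda>c. [:c:]) (\<lambda>i. [:0, Q k $ i:]) f" for f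
  have \<eta>_const: "\<eta> [:c:] = Poly_Mapping.single 0 c"
    and \<eta>_linear: "\<eta> [:0, c:] = Poly_Mapping.single 0 c * tvar s" for c
    by (simp_all add: \<eta>_def mpol_const.map_poly_pCons_hom mult.commute)
  have \<eta>g: "\<eta> (g f) = insertion (Poly_Mapping.single 0) (\<lambda>i. Poly_Mapping.single 0 (Q k $ i) * tvar s) f" for f
    unfolding g_def poly_const.insertion_comp[OF \<eta>.comm_ring_hom_axioms]
    by (simp add: comp_def \<eta>_const \<eta>_linear)
  have \<eta>_polys: "\<eta> h \<in> polys (s + 1)" for h
    unfolding \<eta>_def by (induction h) (simp_all add: mpol_const.map_poly_pCons_hom)
  have cong: "f - \<eta> (g f) \<in> q0" if "f \<in> polys (s + 1)" for f
    using that
  proof (induction rule: polys_induct)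
    case (const c)
    then show ?case using q0(1) by (simp add: \<eta>g)
  next
    case (tvar i)
    \<comment> \<open>The variable u is fixed, since its coordinate is 1; for the other variables
      the difference is one of the linear forms.\<close>
    then show ?case
      using k q0(1) index_append_one[OF P_carrier[OF k(1)]]
      by (cases "i = s") (auto simp: \<eta>g)
  next
    case (add f h)
    have "f + h - \<eta> (g (f + h)) = (f - \<eta> (g f)) + (h - \<eta> (g h))"
      by (simp add: \<eta>g mpol_const.insertion_add)
    then show ?case using add q0(2) by metis
  next
    case (mult f h)
    have "f * h - \<eta> (g (f * h)) = (f - \<eta> (g f)) * h + \<eta> (g f) * (h - \<eta> (g h))"
      by (simp add: \<eta>g mpol_const.insertion_mult algebra_simps)
    then show ?case using mult q0(2,3) \<eta>_polys by (metis mult.commute)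
  qed
  \<comment> \<open>Contraction of an ideal of S[u] to K[u].\<close>
  define J where "J q = {h. \<eta> h \<in> q}" for q
  have J_diff: "a - b \<in> J q" if "primeideal q R" "a \<in> J q" "b \<in> J q" for a b q
    using that primeideal_poly_alg(2)[OF that(1), of "\<eta> a" "- \<eta> b"]
      primeideal_poly_alg(3)[OF that(1), of "\<eta> b" "- 1"]
    by (simp add: J_def \<eta>.hom_minus)
  have J_mult: "a * b \<in> J q" if "primeideal q R" "b \<in> J q" for a b q
    using that primeideal_poly_alg(3)[OF that(1) _ \<eta>_polys] by (simp add: J_def \<eta>.hom_mult)
  have J_prime: "a \<in> J q \<or> b \<in> J q" if "primeideal q R" "a * b \<in> J q" for a b q
    using that primeideal_poly_alg(6)[OF that(1) \<eta>_polys \<eta>_polys] by (simp add: J_def \<eta>.hom_mult)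
  have J_one: "1 \<notin> J q" if "primeideal q R" for q
    using primeideal_poly_alg(5)[OF that] by (simp add: J_def)
  have J_strict: "\<exists>h\<in>J q'. h \<notin> J q"
    if qq: "primeideal q R" "primeideal q' R" "q0 \<subseteq> q" "q \<subset> q'" for q q'
  proof -
    obtain f where f: "f \<in> q'" "f \<notin> q" using qq by blast
    \<comment> \<open>An f in the larger prime but not in the smaller is replaced by its
      representative in u. They differ by an element of q0, which lies in both primes.\<close>
    have r: "f - \<eta> (g f) \<in> q0"
      by (rule cong) (rule primeideal_poly_alg(4)[OF qq(2) f(1)])
    have "- (f - \<eta> (g f)) \<in> q0" using q0(3)[OF r, of "- 1"] by simp
    then have "\<eta> (g f) \<in> q'"
      using primeideal_poly_alg(2)[OF qq(2), of f "- (f - \<eta> (g f))"] f qq by auto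
    moreover have "\<eta> (g f) \<notin> q"
      using primeideal_poly_alg(2)[OF qq(1), of "f - \<eta> (g f)" "\<eta> (g f)"] r f qq by auto
    ultimately show ?thesis by (intro bexI[of _ "g f"]) (auto simp: J_def)
  qed
  \<comment> \<open>The first strict inclusion makes the middle contraction nonzero, hence maximal;
    this contradicts the second one.\<close>
  obtain h where h: "h \<in> J q1" "h \<notin> J q0"
    using J_strict[OF prime(1,2)] chain by blast
  have "0 \<in> J q0" using q0(1) by (simp add: J_def)
  then have "h \<noteq> 0" using h(2) by auto
  have J_sub: "J q1 \<subseteq> J q2" using chain by (auto simp: J_def)
  have "J q1 = J q2"
    by (rule field_poly_prime_ideal_maximal[OF J_diff[OF prime(2)] J_mult[OF prime(2)]
          J_prime[OF prime(2)] J_diff[OF prime(3)] J_mult[OF prime(3)] J_one[OF prime(3)]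
          J_sub h(1) \<open>h \<noteq> 0\<close>])
  then show False
    using J_strict[OF prime(2,3)] chain by blast
qed

text \<open>The ideal of the point (P_0,1) lies in the ideal of the origin, because the origin is
  the value u = 0 on its line. The variable u separates the two.\<close>

lemma prime_chain_of_length_one:
  "\<exists>p. (\<forall>i\<le>1. primeideal (p i) R \<and> I \<subseteq> p i) \<and> (\<forall>i<1. p i \<subset> p (Suc i))"
proof -
  have 0: "P 0 \<in> X" "P 0 \<in> carrier_vec s" using m_pos P_carrier by auto
  let ?g = "insertion (\<lambda>c. [:c:]) (\<lambda>i. [:0, Q 0 $ i:])"
  define p0 p1 where "p0 = {f \<in> polys (s + 1). ?g f = 0}"
    and "p1 = {f \<in> polys (s + 1). insertion id (\<lambda>_. 0 :: 'k) f = 0}"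
  have prime: "primeideal p0 R" "primeideal p1 R"
    unfolding p0_def p1_def
    by (intro primeideal_insertion_kernel poly_const.comm_ring_hom_axioms id_hom.comm_ring_hom_axioms)+
  have I: "I \<subseteq> p0"
    unfolding p0_def by (rule vanishing_ideal_subset_point_ideal[OF X_carrier 0(1)])
  have "insertion id (\<lambda>_. 0) f = poly (?g f) 0" for f
    by (simp add: poly_const.insertion_comp[OF poly_hom.comm_ring_hom_axioms] comp_def id_def)
  then have "p0 \<subseteq> p1" by (auto simp: p0_def p1_def)
  moreover have "tvar s \<in> p1" "tvar s \<notin> p0"
    using 0(2) by (simp_all add: p0_def p1_def)
  ultimately have "p0 \<subset> p1" by blast
  then show ?thesis
    using prime I by (intro exI[of _ "\<lambda>i. if i = 0 then p0 else p1"]) auto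
qed

lemma krull_dim_coordinate_ring: "krull_dim (R Quot I) = 1"
proof -
  interpret R: cring R by (rule cring_poly_alg)
  note iff = R.prime_chain_quot_iff[OF ideal_vanishing_ideal(1)[OF X_carrier]]
  show ?thesis
    using prime_chain_of_length_one no_prime_chain_of_length_two
    by (intro krull_dim_eq_oneI) (simp_all only: iff not_False_eq_True)
qed

end

section \<open>Dimension and degree over a finite field\<close>

locale finite_affine_points = affine_points s m P
  for s m and P :: "nat \<Rightarrow> 'k::{finite, field} vec"
begin

text \<open>Supplies the finiteness from which the comparisons of dimensions draw finite
  dimension.\<close>

lemma finite_affine_code: "finite (C d)"
proof -
  have "carrier_vec m \<subseteq> vec m ` (PiE {..<m} (\<lambda>_. UNIV :: 'k set))"
  proof
    fix x :: "'k vec" assume "x \<in> carrier_vec m"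
    then have "x = vec m (restrict (\<lambda>i. x $ i) {..<m})" by auto
    then show "x \<in> vec m ` (PiE {..<m} (\<lambda>_. UNIV))" 
      by (intro image_eqI[where x = "restrict (\<lambda>i. x $ i) {..<m}"]) auto
  qed
  then have "finite (carrier_vec m :: 'k vec set)"
    by (rule finite_subset) (simp add: finite_PiE)
  then show ?thesis by (rule finite_subset[OF affine_code_carrier])
qed

lemma code_dim_eq: "code_dim (C d) = code_dim (D d)"
proof -
  interpret linear_map class_ring "code_space (C d)" "code_space (D d)" "rescale d"
    by (rule rescale_linear_map)
  have "finite (D d)" using finite_affine_code[of d] by (simp flip: rescale_image)
  then show ?thesis
    unfolding code_dim_def using rescale_bij_betw by (intro dim_eq_of_bij_betw) simp_all
qed

lemma hilbert_fun_eq_code_dim: "hilbert_fun (s + 1) I d = code_dim (D d)"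
proof -
  let ?V = "R\<lparr>carrier := polys_hom (s + 1) d\<rparr>"
  let ?T = "projective_word m Q (tvar 0 ^ d)"
  interpret linear_map class_ring ?V "code_space (D d)" ?T
    using vectorspace_polys_hom[of "s + 1" d] vectorspace_projective_code[of d]
    by (auto simp: linear_map_def mod_hom_def mod_hom_axioms_def module_hom_def vectorspace_def
        poly_alg_def projective_code_def projective_word_add projective_word_smult)
  \<comment> \<open>The denominators are nonzero, so the kernel is cut out by vanishing at the
    (P_i,1), which describes I(Y) in degree d.\<close>
  have "?T f = 0\<^sub>v m \<longleftrightarrow> (\<forall>x\<in>X. peval f (append_one x) = 0)" for f
    using f0_nonzero by (auto simp: vec_eq_iff projective_word_def peval_f0_append_one)
  moreover have "\<zero>\<^bsub>code_space (D d)\<^esub> = 0\<^sub>v m"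
    by (simp add: code_space_def code_length_projective_code module_vec_simps)
  ultimately have "kerT = I \<inter> polys_hom (s + 1) d"
    unfolding vanishing_ideal_Int_polys_hom[OF X_carrier] ker_def by simp
  moreover have "finite (D d)" using finite_affine_code[of d] by (simp flip: rescale_image)
  ultimately show ?thesis
    using dim_quot_module by (simp add: hilbert_fun_def code_dim_def projective_code_def)
qed

text \<open>The Hilbert function has the constant value m from d = m on.\<close>

lemma quot_degree_eq: "quot_degree (s + 1) I = of_nat m"
proof -
  have H: "hilbert_fun (s + 1) I d = m" if "d \<ge> m" for d
    using that by (simp only: hilbert_fun_eq_code_dim flip: code_dim_eq)
      (simp add: affine_code_eq_carrier_vec)
  have "hilbert_poly (s + 1) I = [:of_nat m:]"
    unfolding hilbert_poly_def
  proof (rule the_equality)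
    show "\<exists>N. \<forall>d\<ge>N. poly [:of_nat m:] (of_nat d) = of_nat (hilbert_fun (s + 1) I d)"
      using H by (intro exI[of _ m]) simp
    fix h :: "rat poly"
    assume "\<exists>N. \<forall>d\<ge>N. poly h (of_nat d) = of_nat (hilbert_fun (s + 1) I d)"
    then obtain N where N: "\<And>d. d \<ge> N \<Longrightarrow> poly h (of_nat d) = of_nat (hilbert_fun (s + 1) I d)" by blast
    \<comment> \<open>Uniqueness of the Hilbert polynomial: a competitor agrees with the constant at
      infinitely many integers.\<close>
    have "of_nat ` {max N m..} \<subseteq> {x. poly (h - [:of_nat m:]) x = 0}"
      using N H by auto
    moreover have "infinite (of_nat ` {max N m..} :: rat set)"
      by (subst finite_image_iff) (auto simp: inj_on_def infinite_Ici)
    ultimately have "infinite {x. poly (h - [:of_nat m:]) x = 0}"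
      using finite_subset by blast
    then have "h - [:of_nat m:] = 0" using poly_roots_finite by blast
    then show "h = [:of_nat m:]" by simp
  qed
  \<comment> \<open>For Krull dimension 1 the degree is the coefficient of index 0 times 0!.\<close>
  then show ?thesis
    using krull_dim_coordinate_ring by (simp add: quot_degree_def one_enat_def)
qed

end

section \<open>Application to the toric set\<close>

lemma toric_set_entry:
  assumes "x \<in> toric_set n s v"
  shows "x \<in> carrier_vec s" "i < s \<Longrightarrow> x $ i \<noteq> 0"
  using assms by (auto simp: toric_set_def)

text \<open>The parameter (1,...,1) shows that there is a point, so m >= 1.\<close>

lemma one_in_toric_set: "vec s (\<lambda>_. 1) \<in> toric_set n s v"
  unfolding toric_set_def by (rule CollectI, rule exI[of _ "vec n (\<lambda>_. 1)"]) auto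

theorem theorem2p4:
  fixes n s m d :: nat
    and v :: "nat \<Rightarrow> nat vec"
    and P :: "nat \<Rightarrow> 'k::{finite, field} vec"
  assumes "n \<ge> 1" and "s \<ge> 1"
    and "\<And>i. i < s \<Longrightarrow> v i \<in> carrier_vec n"
    and "bij_betw P {..<m} (toric_set n s v)"
  shows
    "let X = (toric_set n s v :: 'k vec set);
         Y = proj_image X;
         Q = (\<lambda>i. append_one (P i));
         f\<^sub>0 = tvar 0 ^ d;
         C = affine_code s d m P;
         D = projective_code s d m Q
     in
       (\<exists>\<phi>. linear_map class_ring (code_space C) (code_space D) \<phi> \<and> bij_betw \<phi> C D \<and>
          (\<forall>f \<in> polys_le s d.
             \<phi> (affine_word m P f) = projective_word m Q f\<^sub>0 (homogenize s d f) \<and>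
             projective_word m Q f\<^sub>0 (homogenize s d f) = vec m (\<lambda>i. peval f (P i) / peval f\<^sub>0 (P i))))
     \<and> (code_length C = code_length D \<and> code_dim C = code_dim D \<and> min_distance C = min_distance D)
     \<and> (code_dim C = hilbert_fun (s + 1) (vanishing_ideal s Y) d \<and>
        of_nat (code_length C) = quot_degree (s + 1) (vanishing_ideal s Y))"
proof -
  have image: "P ` {..<m} = toric_set n s v" and inj: "inj_on P {..<m}"
    using assms(4) by (auto simp: bij_betw_def)
  interpret finite_affine_points s m P
  proof
    show "m \<ge> 1" using image one_in_toric_set[of s n v] by (cases m) auto
    fix i assume "i < m"
    then have "P i \<in> toric_set n s v" using image by blast
    then show "P i \<in> carrier_vec s" "P i $ 0 \<noteq> 0"
      using toric_set_entry(1)[of "P i" n s v] toric_set_entry(2)[of "P i" n s v 0] \<open>s \<ge> 1\<close> by auto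
  qed (use \<open>s \<ge> 1\<close> inj in auto)
  show ?thesis
    unfolding Let_def image[symmetric]
    using rescale_linear_map rescale_bij_betw rescale_affine_word
    by (intro conjI exI[of _ "rescale d"] ballI)
      (simp_all only: code_length_affine_code code_length_projective_code code_dim_eq min_distance_eq
        hilbert_fun_eq_code_dim quot_degree_eq)
qed

end
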